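(* Let $\mathcal{K}$ be the Koopman operator of a measure-preserving dynamical system on $L^2(\Omega,\omega)$, and for each $N$ let $V_N$ be the span of a dictionary of $N$ functions, with mpEDMD matrices $\mathbb{K}=\mathbb{K}_{N,M}$ computed from $M$ snapshots (see context). Suppose that $\lim_{N\rightarrow\infty}\mathrm{dist}(h,V_{N})=0$ for all $h\in L^2(\Omega,\omega)$ and that, for each fixed $N$, the quadrature converges, i.e. $\lim_{M\to\infty}G_{jk}=\langle\psi_k,\psi_j\rangle$ and $\lim_{M\to\infty}A_{jk}=\langle\mathcal{K}\psi_k,\psi_j\rangle$ for $1\le j,k\le N$. Then for any $g\in L^2(\Omega,\omega)$ and $\pmb{g}_N\in\mathbb{C}^N$ with $\lim_{N\rightarrow\infty}\|g-\Psi \pmb{g}_N\|=0$, $$ \lim_{N\rightarrow\infty}\limsup_{M\rightarrow\infty} \|\mathcal{K}^lg-\Psi\mathbb{K}^l\pmb{g}_N\|=0,\quad \forall l\in\mathbb{N}. $$ If, in addition, $\mathcal{K}$ is unitary, then $$ \lim_{N\rightarrow\infty}\limsup_{M\rightarrow\infty} \|(\mathcal{K}^* )^lg-\Psi\mathbb{K}^{-l}\pmb{g}_N\|=0,\quad \forall l\in\mathbb{N}. $$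
   Context: Setting. $\Omega\subseteq\mathbb{R}^d$, $\omega$ is a positive measure on $\Omega$, and $F:\Omega\to\Omega$ is measurable and preserves $\omega$. The Koopman operator $\mathcal{K}g=g\circ F$ is an isometry on $L^2(\Omega,\omega)$, whose inner product (linear in the first argument) and norm are $\langle\cdot,\cdot\rangle$ and $\|\cdot\|$. mpEDMD. For each $N$ there is a dictionary $\psi_1,\dots,\psi_N\in L^2(\Omega,\omega)$ (possibly depending on $N$), linearly independent, with span $V_N$. Write $\Psi(\pmb{x})=[\psi_1(\pmb{x})\ \cdots\ \psi_N(\pmb{x})]$, and for $\pmb{c}\in\mathbb{C}^N$, $\Psi\pmb{c}=\sum_j c_j\psi_j\in V_N$. For each $M$ the data are points $\pmb{x}^{(m)}\in\Omega$, $\pmb{y}^{(m)}=F(\pmb{x}^{(m)})$, $m=1,\dots,M$, with quadrature weights $w_m\ge 0$ (points and weights may depend on $M$); $W=\mathrm{diag}(w_1,\dots,w_M)$. $\Psi_X,\Psi_Y\in\mathbb{C}^{M\times N}$ are the matrices whose $m$th rows are $\Psi(\pmb{x}^{(m)})$ and $\Psi(\pmb{y}^{(m)})$. Put $G=\Psi_X^*W\Psi_X$ and $A=\Psi_X^*W\Psi_Y$ (both depend on $N,M$); $G$ is assumed invertible. Take any singular value decomposition $G^{-1/2}A^*G^{-1/2}=U_1\Sigma U_2^*$ with $U_1,U_2$ unitary, and set $\mathbb{K}=G^{-1/2}U_2U_1^*G^{1/2}\in\mathbb{C}^{N\times N}$. $\mathrm{dist}(h,V_N)=\inf_{f\in V_N}\|h-f\|$.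 *)

theory Defs
  imports
    "HOL-Analysis.Analysis"
    "Jordan_Normal_Form.Gauss_Jordan_Elimination"
    "Jordan_Normal_Form.Schur_Decomposition"
begin

subsection \<open>The space of complex square-integrable functions\<close>

text \<open>Elements of \<open>L\<^sup>2\<close> are handled through representatives: genuine functions, with equality in
  \<open>L\<^sup>2\<close> expressed as almost-everywhere equality. Point evaluations, which enter the data
  matrices, are therefore meaningful.\<close>

definition L2 :: "'a measure \<Rightarrow> ('a \<Rightarrow> complex) set" where
  "L2 \<omega> = {f \<in> borel_measurable \<omega>. integrable \<omega> (\<lambda>x. (cmod (f x))\<^sup>2)}"

definition L2_inner :: "'a measure \<Rightarrow> ('a \<Rightarrow> complex) \<Rightarrow> ('a \<Rightarrow> complex) \<Rightarrow> complex" where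
  "L2_inner \<omega> f g = (\<integral>x. f x * cnj (g x) \<partial>\<omega>)"

definition L2_norm :: "'a measure \<Rightarrow> ('a \<Rightarrow> complex) \<Rightarrow> real" where
  "L2_norm \<omega> f = sqrt (\<integral>x. (cmod (f x))\<^sup>2 \<partial>\<omega>)"

definition L2_dist :: "'a measure \<Rightarrow> ('a \<Rightarrow> complex) \<Rightarrow> ('a \<Rightarrow> complex) set \<Rightarrow> real" where
  "L2_dist \<omega> h V = (INF f\<in>V. L2_norm \<omega> (\<lambda>x. h x - f x))"

text \<open>\<open>T\<close> is an adjoint of \<open>K\<close>. As a map on representatives it is determined up to
  almost-everywhere equality of its values.\<close>

definition L2_adjoint ::
  "'a measure \<Rightarrow> (('a \<Rightarrow> complex) \<Rightarrow> ('a \<Rightarrow> complex)) \<Rightarrow> (('a \<Rightarrow> complex) \<Rightarrow> ('a \<Rightarrow> complex)) \<Rightarrow> bool"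
  where
  "L2_adjoint \<omega> K T \<longleftrightarrow>
     (\<forall>f\<in>L2 \<omega>. T f \<in> L2 \<omega>) \<and>
     (\<forall>f\<in>L2 \<omega>. \<forall>g\<in>L2 \<omega>. L2_inner \<omega> (K f) g = L2_inner \<omega> f (T g))"

definition L2_unitary :: "'a measure \<Rightarrow> (('a \<Rightarrow> complex) \<Rightarrow> ('a \<Rightarrow> complex)) \<Rightarrow> bool" where
  "L2_unitary \<omega> K \<longleftrightarrow>
     (\<forall>f\<in>L2 \<omega>. K f \<in> L2 \<omega>) \<and>
     (\<exists>T. L2_adjoint \<omega> K T \<and>
        (\<forall>f\<in>L2 \<omega>. (AE x in \<omega>. T (K f) x = f x) \<and> (AE x in \<omega>. K (T f) x = f x)))"

definition measure_preserving :: "'a measure \<Rightarrow> ('a \<Rightarrow> 'a) \<Rightarrow> bool" where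
  "measure_preserving \<omega> F \<longleftrightarrow> F \<in> measurable \<omega> \<omega> \<and> distr \<omega> \<omega> F = \<omega>"

definition koopman :: "('a \<Rightarrow> 'a) \<Rightarrow> ('a \<Rightarrow> complex) \<Rightarrow> ('a \<Rightarrow> complex)" where
  "koopman F g = g \<circ> F"


subsection \<open>Dictionaries\<close>

text \<open>Dictionary functions, data points and vector entries are indexed from \<open>0\<close>.\<close>

definition dict_comb :: "(nat \<Rightarrow> 'a \<Rightarrow> complex) \<Rightarrow> complex Matrix.vec \<Rightarrow> 'a \<Rightarrow> complex" where
  "dict_comb \<psi> c = (\<lambda>x. \<Sum>j<dim_vec c. vec_index c j * \<psi> j x)"

definition dict_span :: "nat \<Rightarrow> (nat \<Rightarrow> 'a \<Rightarrow> complex) \<Rightarrow> ('a \<Rightarrow> complex) set" where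
  "dict_span N \<psi> = dict_comb \<psi> ` carrier_vec N"

definition dict_independent :: "'a measure \<Rightarrow> nat \<Rightarrow> (nat \<Rightarrow> 'a \<Rightarrow> complex) \<Rightarrow> bool" where
  "dict_independent \<omega> N \<psi> \<longleftrightarrow>
     (\<forall>c\<in>carrier_vec N. (AE x in \<omega>. dict_comb \<psi> c x = 0) \<longrightarrow> c = 0\<^sub>v N)"


subsection \<open>Matrix notions\<close>

definition unitary_mat :: "nat \<Rightarrow> complex mat \<Rightarrow> bool" where
  "unitary_mat n U \<longleftrightarrow>
     U \<in> carrier_mat n n \<and> mat_adjoint U * U = 1\<^sub>m n \<and> U * mat_adjoint U = 1\<^sub>m n"

text \<open>The order on \<^typ>\<open>complex\<close> is the one of \<^theory>\<open>HOL-Library.Complex_Order\<close>: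
  \<open>0 \<le> z\<close> means that \<open>z\<close> is real and nonnegative.\<close>

definition pos_semidef_mat :: "nat \<Rightarrow> complex mat \<Rightarrow> bool" where
  "pos_semidef_mat n S \<longleftrightarrow>
     S \<in> carrier_mat n n \<and> mat_adjoint S = S \<and>
     (\<forall>v\<in>carrier_vec n. 0 \<le> (S *\<^sub>v v) \<bullet>c v)"

definition is_mat_sqrt :: "nat \<Rightarrow> complex mat \<Rightarrow> complex mat \<Rightarrow> bool" where
  "is_mat_sqrt n G S \<longleftrightarrow> pos_semidef_mat n S \<and> S * S = G"

text \<open>The value is the inverse for invertible square matrices and unspecified otherwise.\<close>

definition mat_inv :: "complex mat \<Rightarrow> complex mat" where
  "mat_inv A = the (mat_inverse A)"

text \<open>\<open>B = U \<Sigma> V\<^sup>*\<close>; the singular values are not required to be ordered.\<close>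

definition is_svd ::
  "nat \<Rightarrow> complex mat \<Rightarrow> complex mat \<Rightarrow> complex mat \<Rightarrow> complex mat \<Rightarrow> bool" where
  "is_svd n B U D V \<longleftrightarrow>
     unitary_mat n U \<and> unitary_mat n V \<and>
     D \<in> carrier_mat n n \<and> diagonal_mat D \<and> (\<forall>i<n. 0 \<le> D $$ (i, i)) \<and>
     B = U * D * mat_adjoint V"


subsection \<open>The mpEDMD matrices\<close>

definition Psi_mat :: "nat \<Rightarrow> nat \<Rightarrow> (nat \<Rightarrow> 'a \<Rightarrow> complex) \<Rightarrow> (nat \<Rightarrow> 'a) \<Rightarrow> complex mat" where
  "Psi_mat M N \<psi> z = Matrix.mat M N (\<lambda>(m, j). \<psi> j (z m))"

definition weight_mat :: "nat \<Rightarrow> (nat \<Rightarrow> real) \<Rightarrow> complex mat" where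
  "weight_mat M w = mat_diag M (\<lambda>m. complex_of_real (w m))"

definition G_mat ::
  "nat \<Rightarrow> nat \<Rightarrow> (nat \<Rightarrow> 'a \<Rightarrow> complex) \<Rightarrow> (nat \<Rightarrow> 'a) \<Rightarrow> (nat \<Rightarrow> real) \<Rightarrow> complex mat" where
  "G_mat M N \<psi> x w =
     mat_adjoint (Psi_mat M N \<psi> x) * weight_mat M w * Psi_mat M N \<psi> x"

definition A_mat ::
  "nat \<Rightarrow> nat \<Rightarrow> (nat \<Rightarrow> 'a \<Rightarrow> complex) \<Rightarrow> ('a \<Rightarrow> 'a) \<Rightarrow> (nat \<Rightarrow> 'a) \<Rightarrow> (nat \<Rightarrow> real) \<Rightarrow> complex mat"
  where
  "A_mat M N \<psi> F x w =
     mat_adjoint (Psi_mat M N \<psi> x) * weight_mat M w * Psi_mat M N \<psi> (\<lambda>m. F (x m))"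

text \<open>The singular value decomposition, and hence \<open>\<bbbK>\<close>, need not be unique, so this is a
  relation; \<open>S\<close> is the positive semidefinite square root \<open>G\<^sup>1\<^sup>/\<^sup>2\<close>, and \<open>mat_inv S\<close> is its
  inverse \<open>G\<^sup>-\<^sup>1\<^sup>/\<^sup>2\<close>.\<close>

definition is_mpEDMD :: "nat \<Rightarrow> complex mat \<Rightarrow> complex mat \<Rightarrow> complex mat \<Rightarrow> bool" where
  "is_mpEDMD N G A K \<longleftrightarrow>
     (\<exists>S U\<^sub>1 D U\<^sub>2. is_mat_sqrt N G S \<and>
        is_svd N (mat_inv S * mat_adjoint A * mat_inv S) U\<^sub>1 D U\<^sub>2 \<and>
        K = mat_inv S * U\<^sub>2 * mat_adjoint U\<^sub>1 * S)"

end

theory Submission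
  imports Defs
begin

text \<open>With \<open>S = G\<^sup>1\<^sup>/\<^sup>2\<close>, the matrix \<open>\<bbbK>\<close> is the unitary factor, for the inner product given by \<open>G\<close>,
  of a polar decomposition of \<open>G\<inverse> A\<close>: it satisfies \<open>\<bbbK>\<^sup>* G \<bbbK> = G\<close>, and \<open>\<bbbK>\<^sup>* A\<close> is positive
  semidefinite. Expanding this positive form at \<open>u - \<bbbK>\<inverse> v\<close> and letting \<open>M \<rightarrow> \<infinity>\<close> gives the one-step
  bound \<open>limsup \<parallel>\<K> \<Psi>u - \<Psi>\<bbbK>u\<parallel>\<^sup>2 \<le> 2 \<parallel>\<K> \<Psi>u - \<Psi>v\<parallel>\<^sup>2\<close> for all coefficient vectors \<open>u\<close> and \<open>v\<close>. An
  induction on the power of \<open>\<bbbK>\<close> then follows by replacing \<open>\<K>\<^sup>l g\<close> and \<open>\<K>\<^sup>l\<^sup>+\<^sup>1 g\<close> with approximants in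
  \<open>V\<^sub>N\<close>, since \<open>\<bbbK>\<close> is asymptotically an isometry for the \<open>L\<^sup>2\<close> norm. The pair of properties is
  symmetric: if \<open>\<bbbK>\<close> satisfies them for \<open>A\<close>, then \<open>\<bbbK>\<inverse>\<close> satisfies them for \<open>A\<^sup>*\<close>, which approximates
  \<open>\<K>\<^sup>*\<close>. So the same argument covers the second claim.\<close>

subsection \<open>Polar factors of matrices\<close>

lemma mat_adjoint_carrier [simp]:
  "A \<in> carrier_mat n m \<Longrightarrow> mat_adjoint A \<in> carrier_mat m n"
  unfolding mat_adjoint_def by auto

lemma mat_adjoint_dim:
  "dim_row (mat_adjoint A) = dim_col A" "dim_col (mat_adjoint A) = dim_row A"
  unfolding mat_adjoint_def by auto

lemma mat_adjoint_index:
  fixes A :: "complex mat"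
  assumes "A \<in> carrier_mat n m" "i < m" "j < n"
  shows "mat_adjoint A $$ (i, j) = cnj (A $$ (j, i))"
  using assms unfolding mat_adjoint_def by (auto simp: mat_of_rows_index)

lemma mat_adjoint_adjoint:
  fixes A :: "complex mat"
  assumes "A \<in> carrier_mat n m"
  shows "mat_adjoint (mat_adjoint A) = A"
  by (rule eq_matI) (use assms in \<open>auto simp: mat_adjoint_dim mat_adjoint_index[of _ m n] mat_adjoint_index[of _ n m]\<close>)

lemma mat_adjoint_one: "mat_adjoint (1\<^sub>m n) = (1\<^sub>m n :: complex mat)"
  by (rule eq_matI) (auto simp: mat_adjoint_dim mat_adjoint_index[of _ n n])

lemma mat_adjoint_mult:
  fixes A B :: "complex mat"
  assumes A: "A \<in> carrier_mat n m" and B: "B \<in> carrier_mat m k"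
  shows "mat_adjoint (A * B) = mat_adjoint B * mat_adjoint A"
proof (rule eq_matI)
  fix i j assume "i < dim_row (mat_adjoint B * mat_adjoint A)"
    "j < dim_col (mat_adjoint B * mat_adjoint A)"
  then have i: "i < k" and j: "j < n"
    using mat_adjoint_carrier[OF A] mat_adjoint_carrier[OF B] by auto
  have "mat_adjoint (A * B) $$ (i, j) = cnj ((A * B) $$ (j, i))"
    by (rule mat_adjoint_index[of _ n k]) (use A B i j in auto)
  also have "\<dots> = (\<Sum>l<m. cnj (B $$ (l, i)) * cnj (A $$ (j, l)))"
    using A B i j by (simp add: scalar_prod_def atLeast0LessThan mult.commute)
  also have "\<dots> = (mat_adjoint B * mat_adjoint A) $$ (i, j)"
    using mat_adjoint_carrier[OF A] mat_adjoint_carrier[OF B] i j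
    by (simp add: scalar_prod_def atLeast0LessThan mat_adjoint_index[OF A] mat_adjoint_index[OF B])
  finally show "mat_adjoint (A * B) $$ (i, j) = (mat_adjoint B * mat_adjoint A) $$ (i, j)" .
qed (use mat_adjoint_carrier[OF A] mat_adjoint_carrier[OF B]
    mat_adjoint_carrier[OF mult_carrier_mat[OF A B]] in auto)

lemma cscalar_prod_sum:
  fixes A :: "complex mat"
  assumes A: "A \<in> carrier_mat n m" and u: "u \<in> carrier_vec m" and v: "v \<in> carrier_vec n"
  shows "(A *\<^sub>v u) \<bullet>c v = (\<Sum>j<n. \<Sum>k<m. A $$ (j, k) * vec_index u k * cnj (vec_index v j))"
  using A u v by (simp add: scalar_prod_def atLeast0LessThan sum_distrib_right)

lemma cscalar_prod_adjoint:
  fixes A :: "complex mat"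
  assumes A: "A \<in> carrier_mat n m" and u: "u \<in> carrier_vec m" and v: "v \<in> carrier_vec n"
  shows "(mat_adjoint A *\<^sub>v v) \<bullet>c u = cnj ((A *\<^sub>v u) \<bullet>c v)"
proof -
  have "(mat_adjoint A *\<^sub>v v) \<bullet>c u =
      (\<Sum>k<m. \<Sum>j<n. mat_adjoint A $$ (k, j) * vec_index v j * cnj (vec_index u k))"
    by (rule cscalar_prod_sum[OF mat_adjoint_carrier[OF A] v u])
  also have "\<dots> = (\<Sum>k<m. \<Sum>j<n. cnj (A $$ (j, k) * vec_index u k * cnj (vec_index v j)))"
    by (intro sum.cong refl) (simp add: mat_adjoint_index[OF A] mult_ac)
  also have "\<dots> = cnj ((A *\<^sub>v u) \<bullet>c v)"
    unfolding cscalar_prod_sum[OF A u v] by (subst sum.swap) simp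
  finally show ?thesis .
qed

lemma cscalar_prod_adjoint_mult:
  fixes A B :: "complex mat"
  assumes A: "A \<in> carrier_mat n n" and B: "B \<in> carrier_mat n n"
    and u: "u \<in> carrier_vec n" and v: "v \<in> carrier_vec n"
  shows "((mat_adjoint B * A) *\<^sub>v u) \<bullet>c v = (A *\<^sub>v u) \<bullet>c (B *\<^sub>v v)"
proof -
  have "(A *\<^sub>v u) \<bullet>c (B *\<^sub>v v) = cnj ((mat_adjoint (mat_adjoint B) *\<^sub>v v) \<bullet>c (A *\<^sub>v u))"
    unfolding mat_adjoint_adjoint[OF B] using A B u v
    by (simp add: scalar_prod_def mult.commute)
  also have "\<dots> = (mat_adjoint B *\<^sub>v (A *\<^sub>v u)) \<bullet>c v"
    by (subst cscalar_prod_adjoint[of _ n n]) (use A B u v in auto)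
  also have "\<dots> = ((mat_adjoint B * A) *\<^sub>v u) \<bullet>c v"
    using A B u by (simp add: assoc_mult_mat_vec[OF mat_adjoint_carrier[OF B]])
  finally show ?thesis ..
qed

lemma mat_inv_inverse:
  assumes A: "A \<in> carrier_mat n n" and B: "B \<in> carrier_mat n n" and AB: "A * B = 1\<^sub>m n"
  shows "mat_inv A \<in> carrier_mat n n" "A * mat_inv A = 1\<^sub>m n" "mat_inv A * A = 1\<^sub>m n"
proof -
  have BA: "B * A = 1\<^sub>m n"
    by (rule mat_mult_left_right_inverse[OF A B AB])
  have "A \<in> Units (ring_mat TYPE(complex) n ())"
    unfolding Units_def using A B AB BA by (auto simp: ring_mat_simps)
  then obtain C where "mat_inverse A = Some C"
    using mat_inverse(1)[OF A, of "()"] by (cases "mat_inverse A") auto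
  then show "mat_inv A \<in> carrier_mat n n" "A * mat_inv A = 1\<^sub>m n" "mat_inv A * A = 1\<^sub>m n"
    using mat_inverse(2)[OF A] by (auto simp: mat_inv_def)
qed

lemma invertible_mat_if_trivial_kernel:
  fixes A :: "complex mat"
  assumes A: "A \<in> carrier_mat n n"
    and ker: "\<And>v. v \<in> carrier_vec n \<Longrightarrow> A *\<^sub>v v = 0\<^sub>v n \<Longrightarrow> v = 0\<^sub>v n"
  obtains B where "B \<in> carrier_mat n n" "A * B = 1\<^sub>m n" "B * A = 1\<^sub>m n" "invertible_mat A"
proof -
  have "Determinant.det A \<noteq> 0"
    using det_0_iff_vec_prod_zero[OF A] ker by blast
  from det_non_zero_imp_unit[OF A this, of "()"]
  obtain B where "B \<in> carrier_mat n n" "A * B = 1\<^sub>m n" "B * A = 1\<^sub>m n"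
    unfolding Units_def by (auto simp: ring_mat_simps)
  then show thesis
    using A by (intro that[of B]) (auto simp: invertible_mat_def inverts_mat_def)
qed

section \<open>Congruence of positive semidefinite matrices and polar factors relative to
  \<open>G\<close>\<close>

lemma pos_semidef_mat_conjugate:
  assumes H: "pos_semidef_mat n H" and L: "L \<in> carrier_mat n n"
  shows "pos_semidef_mat n (mat_adjoint L * H * L)"
proof -
  have Hc: "H \<in> carrier_mat n n" and Hh: "mat_adjoint H = H"
    and Hp: "\<And>v. v \<in> carrier_vec n \<Longrightarrow> 0 \<le> (H *\<^sub>v v) \<bullet>c v"
    using H by (auto simp: pos_semidef_mat_def)
  note La = mat_adjoint_carrier[OF L]
  have c: "mat_adjoint L * H * L \<in> carrier_mat n n" using mult_carrier_mat[OF mult_carrier_mat[OF La Hc] L] .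
  have e: "mat_adjoint L * H * L = mat_adjoint L * (H * L)"
    by (rule assoc_mult_mat[OF La Hc L])
  have "mat_adjoint (mat_adjoint L * H * L) = mat_adjoint (H * L) * mat_adjoint (mat_adjoint L)"
    unfolding e by (rule mat_adjoint_mult[OF La mult_carrier_mat[OF Hc L]])
  also have "\<dots> = mat_adjoint L * H * L"
    by (simp add: mat_adjoint_mult[OF Hc L] Hh mat_adjoint_adjoint[OF L])
  finally have "mat_adjoint (mat_adjoint L * H * L) = mat_adjoint L * H * L" .
  moreover have "0 \<le> ((mat_adjoint L * H * L) *\<^sub>v v) \<bullet>c v" if v: "v \<in> carrier_vec n" for v
  proof -
    have "((mat_adjoint L * H * L) *\<^sub>v v) \<bullet>c v = ((H * L) *\<^sub>v v) \<bullet>c (L *\<^sub>v v)"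
      unfolding e by (rule cscalar_prod_adjoint_mult[OF mult_carrier_mat[OF Hc L] L v v])
    also have "\<dots> = (H *\<^sub>v (L *\<^sub>v v)) \<bullet>c (L *\<^sub>v v)"
      using Hc L v by simp
    finally show ?thesis using Hp[of "L *\<^sub>v v"] L v by simp
  qed
  ultimately show ?thesis using c by (simp add: pos_semidef_mat_def)
qed

text \<open>This records only what later steps use of the mpEDMD matrix: no square root or singular
  value decomposition appears, so the choice of decomposition becomes irrelevant. For invertible
  \<open>G\<close> it says that \<open>G\<^sup>-\<^sup>1 A = Q P\<close>, where \<open>Q\<close> is
  unitary and \<open>P = G\<^sup>-\<^sup>1 Q\<^sup>* A\<close> is positive and self-adjoint, both
  for the inner product given by \<open>G\<close>.\<close>

definition polar_factor :: "nat \<Rightarrow> complex mat \<Rightarrow> complex mat \<Rightarrow> complex mat \<Rightarrow> bool" where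
  "polar_factor n G A Q \<longleftrightarrow>
     Q \<in> carrier_mat n n \<and> (\<exists>L\<in>carrier_mat n n. Q * L = 1\<^sub>m n) \<and>
     mat_adjoint Q * G * Q = G \<and> pos_semidef_mat n (mat_adjoint Q * A)"

text \<open>Both conditions are multiplied by \<open>L\<^sup>*\<close> on the left and by
  \<open>L\<close> on the right, where \<open>L\<close> is the inverse of \<open>Q\<close>. The
  second one turns \<open>Q\<^sup>* A\<close> into \<open>A L\<close>; this is again positive, hence
  Hermitian, so it equals \<open>L\<^sup>* A\<^sup>*\<close>, which is the form required for the
  adjoint data.\<close>

lemma polar_factor_inverse:
  assumes P: "polar_factor n G A Q" and G: "G \<in> carrier_mat n n" and A: "A \<in> carrier_mat n n"
  shows "polar_factor n G (mat_adjoint A) (mat_inv Q)"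
proof -
  define L where "L = mat_inv Q"
  have Q: "Q \<in> carrier_mat n n" and QG: "mat_adjoint Q * G * Q = G"
    and H: "pos_semidef_mat n (mat_adjoint Q * A)"
    using P by (auto simp: polar_factor_def)
  have L: "L \<in> carrier_mat n n" "Q * L = 1\<^sub>m n" "L * Q = 1\<^sub>m n"
    using P mat_inv_inverse[of Q n] by (auto simp: polar_factor_def L_def)
  note Qa = mat_adjoint_carrier[OF Q] and La = mat_adjoint_carrier[OF L(1)]
  have LQ: "mat_adjoint L * mat_adjoint Q = 1\<^sub>m n"
  proof -
    have "mat_adjoint L * mat_adjoint Q = mat_adjoint (1\<^sub>m n)"
      using mat_adjoint_mult[OF Q L(1)] L by simp
    then show ?thesis by (simp add: mat_adjoint_one)
  qed
  have cancel: "mat_adjoint L * (mat_adjoint Q * X) = X" if "X \<in> carrier_mat n n" for X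
    using assoc_mult_mat[OF La Qa that] that LQ by simp
  have "mat_adjoint L * G * L = mat_adjoint L * (mat_adjoint Q * (G * Q)) * L"
    using QG assoc_mult_mat[OF Qa G Q] by simp
  also have "\<dots> = (G * Q) * L" using cancel G Q by simp
  also have "\<dots> = G" using assoc_mult_mat[OF G Q L(1)] L G by simp
  finally have 1: "mat_adjoint L * G * L = G" .
  have "mat_adjoint L * (mat_adjoint Q * A) * L = A * L"
    using cancel A by simp
  then have psd: "pos_semidef_mat n (A * L)"
    using pos_semidef_mat_conjugate[OF H L(1)] by simp
  have "mat_adjoint L * mat_adjoint A = A * L"
    using psd mat_adjoint_mult[OF A L(1)] by (simp add: pos_semidef_mat_def)
  then show ?thesis
    unfolding polar_factor_def L_def[symmetric] using 1 L Q psd by auto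
qed

text \<open>Write \<open>R\<close> for the inverse of \<open>S\<close>. The decomposition gives
  \<open>A = S V D U\<^sup>* S\<close>, while \<open>K\<^sup>* = S U V\<^sup>* R\<close>. The inner
  factors cancel in the product and leave \<open>K\<^sup>* A = S U D U\<^sup>* S\<close>, a
  congruence of the nonnegative diagonal matrix \<open>D\<close>. Invariance of
  \<open>G = S S\<close> holds because \<open>K\<close> is conjugate by \<open>S\<close> to the
  unitary matrix \<open>V U\<^sup>*\<close>.\<close>

lemma mpEDMD_polar_factor:
  assumes K: "is_mpEDMD n G A K" and G: "G \<in> carrier_mat n n" and inv: "invertible_mat G"
    and A: "A \<in> carrier_mat n n"
  shows "polar_factor n G A K"
proof -
  obtain S U D V where S: "is_mat_sqrt n G S"
    and svd: "is_svd n (mat_inv S * mat_adjoint A * mat_inv S) U D V"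
    and Keq: "K = mat_inv S * V * mat_adjoint U * S"
    using K by (auto simp: is_mpEDMD_def)
  have Sc: "S \<in> carrier_mat n n" and Sh: "mat_adjoint S = S" and SS: "S * S = G"
    using S by (auto simp: is_mat_sqrt_def pos_semidef_mat_def)
  \<comment> \<open>\<open>invertible_mat\<close> yields an inverse without stating its size; the
    dimensions are read off from the two products.\<close>
  obtain B where B: "B \<in> carrier_mat n n" "G * B = 1\<^sub>m n"
  proof -
    obtain B where e: "G * B = 1\<^sub>m (dim_row G)" "B * G = 1\<^sub>m (dim_row B)"
      using inv by (auto simp: invertible_mat_def inverts_mat_def)
    have "dim_col B = n" using arg_cong[OF e(1), of dim_col] G by simp
    moreover have "dim_row B = n" using arg_cong[OF e(2), of dim_col] G by simp
    ultimately show thesis using that e G by auto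
  qed
  define R where "R = mat_inv S"
  have SB: "S * (S * B) = 1\<^sub>m n"
    using assoc_mult_mat[OF Sc Sc B(1)] SS B by simp
  have R: "R \<in> carrier_mat n n" "S * R = 1\<^sub>m n" "R * S = 1\<^sub>m n"
    using mat_inv_inverse[OF Sc _ SB] Sc B by (auto simp: R_def)
  have U: "U \<in> carrier_mat n n" "mat_adjoint U * U = 1\<^sub>m n" "U * mat_adjoint U = 1\<^sub>m n"
    and V: "V \<in> carrier_mat n n" "mat_adjoint V * V = 1\<^sub>m n" "V * mat_adjoint V = 1\<^sub>m n"
    and D: "D \<in> carrier_mat n n" "diagonal_mat D" "\<And>i. i < n \<Longrightarrow> 0 \<le> D $$ (i, i)"
    and dec: "R * mat_adjoint A * R = U * D * mat_adjoint V"
    using svd by (auto simp: is_svd_def unitary_mat_def R_def)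
  have Rh: "mat_adjoint R = R"
  proof -
    have "mat_adjoint R * S = mat_adjoint (1\<^sub>m n)"
      using mat_adjoint_mult[OF Sc R(1)] Sh R by simp
    then have "mat_adjoint R * S = 1\<^sub>m n" by (simp add: mat_adjoint_one)
    then have "mat_adjoint R * S * R = R" using R by simp
    then show ?thesis
      using assoc_mult_mat[OF mat_adjoint_carrier[OF R(1)] Sc R(1)] R
        right_mult_one_mat[OF mat_adjoint_carrier[OF R(1)]] by simp
  qed
  note Ua = mat_adjoint_carrier[OF U(1)] and Va = mat_adjoint_carrier[OF V(1)]
  note car = Sc R(1) U(1) Ua V(1) Va D(1) A mat_adjoint_carrier[OF A]
  \<comment> \<open>Products are kept nested to the right by \<open>assoc\<close>;
    \<open>cancel\<close> then removes an adjacent inverse pair that stands in front of a further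
    factor.\<close>
  have cancel: "X * (Y * Z) = Z" if "X * Y = 1\<^sub>m n" "X \<in> carrier_mat n n" "Y \<in> carrier_mat n n"
    "Z \<in> carrier_mat n n" for X Y Z :: "complex mat"
    using assoc_mult_mat[OF that(2-4)] that by simp
  note assoc = assoc_mult_mat[of _ n n _ n _ n] and mult_closed = mult_carrier_mat[of _ n n _ n]
  have Kc: "K \<in> carrier_mat n n" unfolding Keq R_def[symmetric] using car by auto
  have Keq': "K = R * (V * (mat_adjoint U * S))"
    unfolding Keq R_def[symmetric] using car by (simp add: assoc)
  have Kadj: "mat_adjoint K = S * (U * (mat_adjoint V * R))"
    unfolding Keq' using car
    by (simp add: mat_adjoint_mult[of _ n n _ n] mat_adjoint_adjoint[of _ n n] Sh Rh assoc mult_closed)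
  \<comment> \<open>This is the inverse of \<open>K\<close>, obtained by swapping the two unitary
    factors.\<close>
  define L where "L = R * (U * (mat_adjoint V * S))"
  have Lc: "L \<in> carrier_mat n n" unfolding L_def using car by auto
  have KL: "K * L = 1\<^sub>m n"
    unfolding Keq' L_def using car by (simp add: assoc mult_closed cancel R U V)
  have KGK: "mat_adjoint K * G * K = G"
    unfolding Kadj unfolding Keq' SS[symmetric] using car by (simp add: assoc mult_closed cancel R U V)
  have RAR: "R * A * R = V * (mat_adjoint D * mat_adjoint U)"
  proof -
    have "R * A * R = mat_adjoint (R * mat_adjoint A * R)"
      using car by (simp add: mat_adjoint_mult[of _ n n _ n] mat_adjoint_adjoint[of _ n n] Rh assoc mult_closed)
    also have "\<dots> = V * (mat_adjoint D * mat_adjoint U)"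
      unfolding dec using car
      by (simp add: mat_adjoint_mult[of _ n n _ n] mat_adjoint_adjoint[of _ n n] assoc mult_closed)
    finally show ?thesis .
  qed
  \<comment> \<open>Nonnegativity in the order on complex numbers forces the diagonal entries to be
    real.\<close>
  have Dh: "mat_adjoint D = D"
  proof (rule eq_matI)
    fix i j assume "i < dim_row D" "j < dim_col D"
    then have ij: "i < n" "j < n" using D(1) by auto
    show "mat_adjoint D $$ (i, j) = D $$ (i, j)"
    proof (cases "i = j")
      case True
      have "Im (D $$ (i, i)) = 0" using D(3)[of i] ij by (simp add: less_eq_complex_def)
      then show ?thesis using True ij by (simp add: mat_adjoint_index[OF D(1)] complex_eq_iff)
    next
      case False
      then show ?thesis
        using ij D by (auto simp: mat_adjoint_index[OF D(1)] diagonal_mat_def)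
    qed
  qed (use D(1) in \<open>auto simp: mat_adjoint_def\<close>)
  have Dpsd: "pos_semidef_mat n D"
  proof -
    have "0 \<le> (D *\<^sub>v v) \<bullet>c v" if v: "v \<in> carrier_vec n" for v
    proof -
      have "(D *\<^sub>v v) \<bullet>c v = (\<Sum>j<n. \<Sum>k<n. if k = j then
          D $$ (j, j) * (vec_index v j * cnj (vec_index v j)) else 0)"
        unfolding cscalar_prod_sum[OF D(1) v v] using D
        by (intro sum.cong refl) (auto simp: diagonal_mat_def)
      also have "\<dots> = (\<Sum>j<n. D $$ (j, j) * (vec_index v j * cnj (vec_index v j)))"
        by simp
      also have "0 \<le> \<dots>"
        using D(3) by (intro sum_nonneg) (simp add: less_eq_complex_def)
      finally show ?thesis .
    qed
    then show ?thesis using D Dh by (simp add: pos_semidef_mat_def)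
  qed
  have SRA: "A = S * ((R * A * R) * S)"
    using car by (simp add: assoc mult_closed cancel R)
  have "mat_adjoint K * A = S * (U * (mat_adjoint V * (R * (S * ((R * A * R) * S)))))"
    unfolding Kadj using SRA car by (simp add: assoc mult_closed)
  also have "\<dots> = S * (U * (D * (mat_adjoint U * S)))"
    unfolding RAR Dh using car by (simp add: assoc mult_closed cancel R V)
  also have "\<dots> = mat_adjoint (mat_adjoint U * S) * D * (mat_adjoint U * S)"
    using car by (simp add: mat_adjoint_mult[of _ n n _ n] mat_adjoint_adjoint[of _ n n] Sh assoc mult_closed)
  finally have "mat_adjoint K * A = mat_adjoint (mat_adjoint U * S) * D * (mat_adjoint U * S)" .
  moreover have "pos_semidef_mat n (mat_adjoint (mat_adjoint U * S) * D * (mat_adjoint U * S))"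
    by (rule pos_semidef_mat_conjugate[OF Dpsd mult_closed[OF Ua Sc]])
  ultimately have "pos_semidef_mat n (mat_adjoint K * A)" by simp
  then show ?thesis
    unfolding polar_factor_def using Kc Lc KL KGK by auto
qed

text \<open>The positive semidefinite form \<open>(a, b) \<mapsto> \<langle>A a, Q b\<rangle>\<close> is nonnegative at \<open>u - t\<close>.\<close>

lemma polar_factor_optimal:
  assumes P: "polar_factor n G A Q" and A: "A \<in> carrier_mat n n"
    and u: "u \<in> carrier_vec n" and t: "t \<in> carrier_vec n"
  shows "2 * Re ((A *\<^sub>v u) \<bullet>c (Q *\<^sub>v t)) \<le> Re ((A *\<^sub>v u) \<bullet>c (Q *\<^sub>v u)) + Re ((A *\<^sub>v t) \<bullet>c (Q *\<^sub>v t))"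
proof -
  define H where "H = mat_adjoint Q * A"
  have Q: "Q \<in> carrier_mat n n" and H: "pos_semidef_mat n H"
    using P by (auto simp: polar_factor_def H_def)
  have Hc: "H \<in> carrier_mat n n" and Hh: "mat_adjoint H = H"
    using H by (auto simp: pos_semidef_mat_def)
  have p: "(A *\<^sub>v a) \<bullet>c (Q *\<^sub>v b) = (H *\<^sub>v a) \<bullet>c b"
    if "a \<in> carrier_vec n" "b \<in> carrier_vec n" for a b
    unfolding H_def by (rule cscalar_prod_adjoint_mult[OF A Q that, symmetric])
  have sym: "(H *\<^sub>v t) \<bullet>c u = cnj ((H *\<^sub>v u) \<bullet>c t)"
    using cscalar_prod_adjoint[OF Hc u t] Hh by simp
  have "0 \<le> (H *\<^sub>v (u - t)) \<bullet>c (u - t)"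
    using H u t by (auto simp: pos_semidef_mat_def)
  also have "\<dots> = (H *\<^sub>v u) \<bullet>c u - (H *\<^sub>v u) \<bullet>c t - (H *\<^sub>v t) \<bullet>c u + (H *\<^sub>v t) \<bullet>c t"
    unfolding cscalar_prod_sum[OF Hc u u] cscalar_prod_sum[OF Hc u t] cscalar_prod_sum[OF Hc t u]
      cscalar_prod_sum[OF Hc t t] cscalar_prod_sum[OF Hc minus_carrier_vec[OF u t] minus_carrier_vec[OF u t]]
    unfolding sum_subtractf[symmetric] sum.distrib[symmetric]
    by (intro sum.cong refl) (use u t in \<open>simp add: algebra_simps\<close>)
  finally have "0 \<le> Re ((H *\<^sub>v u) \<bullet>c u - (H *\<^sub>v u) \<bullet>c t - cnj ((H *\<^sub>v u) \<bullet>c t) + (H *\<^sub>v t) \<bullet>c t)"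
    unfolding sym less_eq_complex_def by simp
  then show ?thesis by (simp add: p[OF u t] p[OF u u] p[OF t t])
qed

subsection \<open>The semi-inner product on square-integrable functions\<close>

lemma L2_product_integrable:
  assumes "f \<in> L2 \<omega>" "g \<in> L2 \<omega>"
  shows "integrable \<omega> (\<lambda>x. f x * cnj (g x))"
proof (rule Bochner_Integration.integrable_bound)
  show "integrable \<omega> (\<lambda>x. (cmod (f x))\<^sup>2 + (cmod (g x))\<^sup>2)"
    using assms by (auto simp: L2_def)
  have "cnj \<in> borel_measurable borel"
    by (intro borel_measurable_continuous_onI continuous_intros)
  then show "(\<lambda>x. f x * cnj (g x)) \<in> borel_measurable \<omega>"
    using assms by (auto simp: L2_def intro: measurable_compose)
  have "cmod (f x) * cmod (g x) \<le> (cmod (f x))\<^sup>2 + (cmod (g x))\<^sup>2" for x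
    using sum_squares_bound[of "cmod (f x)" "cmod (g x)"]
      mult_nonneg_nonneg[OF norm_ge_zero norm_ge_zero, of "f x" "g x"] by linarith
  then show "AE x in \<omega>. norm (f x * cnj (g x)) \<le> norm ((cmod (f x))\<^sup>2 + (cmod (g x))\<^sup>2)"
    by (auto simp: norm_mult)
qed

lemma L2_add:
  assumes f: "f \<in> L2 \<omega>" and g: "g \<in> L2 \<omega>"
  shows "(\<lambda>x. f x + g x) \<in> L2 \<omega>"
proof -
  have "integrable \<omega> (\<lambda>x. (cmod (f x + g x))\<^sup>2)"
  proof (rule Bochner_Integration.integrable_bound)
    show "integrable \<omega> (\<lambda>x. 2 * (cmod (f x))\<^sup>2 + 2 * (cmod (g x))\<^sup>2)"
      using f g by (auto simp: L2_def)
    show "(\<lambda>x. (cmod (f x + g x))\<^sup>2) \<in> borel_measurable \<omega>"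
      using f g by (auto simp: L2_def)
    have "(cmod (f x + g x))\<^sup>2 \<le> 2 * (cmod (f x))\<^sup>2 + 2 * (cmod (g x))\<^sup>2" for x
    proof -
      have "(cmod (f x + g x))\<^sup>2 \<le> (cmod (f x) + cmod (g x))\<^sup>2"
        by (intro power_mono norm_triangle_ineq) auto
      then show ?thesis
        using sum_squares_bound[of "cmod (f x)" "cmod (g x)"] by (simp add: power2_sum)
    qed
    then show "AE x in \<omega>. norm ((cmod (f x + g x))\<^sup>2) \<le> norm (2 * (cmod (f x))\<^sup>2 + 2 * (cmod (g x))\<^sup>2)"
      by auto
  qed
  then show ?thesis using f g by (auto simp: L2_def)
qed

lemma L2_scale:
  assumes "f \<in> L2 \<omega>"
  shows "(\<lambda>x. a * f x) \<in> L2 \<omega>"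
  using assms by (auto simp: L2_def norm_mult power_mult_distrib)

lemma L2_diff:
  assumes "f \<in> L2 \<omega>" "g \<in> L2 \<omega>"
  shows "(\<lambda>x. f x - g x) \<in> L2 \<omega>"
  using L2_add[OF assms(1) L2_scale[OF assms(2), of "-1"]] by simp

lemma L2_sum:
  assumes "\<And>i. i \<in> I \<Longrightarrow> f i \<in> L2 \<omega>"
  shows "(\<lambda>x. \<Sum>i\<in>I. f i x) \<in> L2 \<omega>"
  using assms by (induction I rule: infinite_finite_induct) (auto simp: L2_add, auto simp: L2_def)

lemma L2_dict_comb:
  assumes "\<And>j. j < n \<Longrightarrow> \<phi> j \<in> L2 \<omega>" "u \<in> carrier_vec n"
  shows "dict_comb \<phi> u \<in> L2 \<omega>"
  unfolding dict_comb_def using assms by (intro L2_sum L2_scale) auto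

lemma L2_inner_diff_left:
  assumes "f \<in> L2 \<omega>" "g \<in> L2 \<omega>" "h \<in> L2 \<omega>"
  shows "L2_inner \<omega> (\<lambda>x. f x - g x) h = L2_inner \<omega> f h - L2_inner \<omega> g h"
  unfolding L2_inner_def left_diff_distrib
  by (intro Bochner_Integration.integral_diff L2_product_integrable assms)

lemma L2_inner_scale_left: "L2_inner \<omega> (\<lambda>x. a * f x) h = a * L2_inner \<omega> f h"
  unfolding L2_inner_def by (simp add: mult.assoc)

lemma L2_inner_cnj: "cnj (L2_inner \<omega> f g) = L2_inner \<omega> g f"
  unfolding L2_inner_def by (simp add: Bochner_Integration.integral_cnj[symmetric] mult.commute)

lemma L2_inner_sum_left:
  assumes "\<And>i. i \<in> I \<Longrightarrow> f i \<in> L2 \<omega>" "h \<in> L2 \<omega>"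
  shows "L2_inner \<omega> (\<lambda>x. \<Sum>i\<in>I. f i x) h = (\<Sum>i\<in>I. L2_inner \<omega> (f i) h)"
  unfolding L2_inner_def sum_distrib_right
  by (intro Bochner_Integration.integral_sum L2_product_integrable assms)

lemma L2_norm_nonneg [simp]: "0 \<le> L2_norm \<omega> f"
  by (simp add: L2_norm_def)

lemma L2_norm_power2: "(L2_norm \<omega> f)\<^sup>2 = (\<integral>x. (cmod (f x))\<^sup>2 \<partial>\<omega>)"
  by (simp add: L2_norm_def)

lemma L2_inner_self: "L2_inner \<omega> f f = complex_of_real ((L2_norm \<omega> f)\<^sup>2)"
  unfolding L2_norm_power2 L2_inner_def complex_norm_square[symmetric]
  by (simp flip: of_real_power)

lemma L2_norm_cong_AE:
  assumes "f \<in> L2 \<omega>" "g \<in> L2 \<omega>" "AE x in \<omega>. f x = g x"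
  shows "L2_norm \<omega> f = L2_norm \<omega> g"
  unfolding L2_norm_def
  using assms by (auto simp: L2_def intro!: arg_cong[where f=sqrt] integral_cong_AE)

lemma L2_norm_eq_0_AE:
  assumes "f \<in> L2 \<omega>" "L2_norm \<omega> f = 0"
  shows "AE x in \<omega>. f x = 0"
proof -
  have "(\<integral>x. (cmod (f x))\<^sup>2 \<partial>\<omega>) = 0" using assms(2) by (simp add: L2_norm_def)
  then show ?thesis
    using assms(1) by (subst (asm) integral_nonneg_eq_0_iff_AE) (auto simp: L2_def)
qed

lemma L2_norm_minus_commute: "L2_norm \<omega> (\<lambda>x. f x - g x) = L2_norm \<omega> (\<lambda>x. g x - f x)"
  by (simp add: L2_norm_def norm_minus_commute)

lemma L2_norm_diff_power2:
  assumes f: "f \<in> L2 \<omega>" and g: "g \<in> L2 \<omega>"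
  shows "(L2_norm \<omega> (\<lambda>x. f x - g x))\<^sup>2 = (L2_norm \<omega> f)\<^sup>2 + (L2_norm \<omega> g)\<^sup>2 - 2 * Re (L2_inner \<omega> f g)"
proof -
  have d: "(\<lambda>x. f x - g x) \<in> L2 \<omega>" by (rule L2_diff[OF f g])
  have "L2_inner \<omega> (\<lambda>x. f x - g x) (\<lambda>x. f x - g x)
      = cnj (L2_inner \<omega> (\<lambda>x. f x - g x) f) - cnj (L2_inner \<omega> (\<lambda>x. f x - g x) g)"
    unfolding L2_inner_diff_left[OF f g d] by (simp add: L2_inner_cnj)
  also have "Re \<dots> = (L2_norm \<omega> f)\<^sup>2 + (L2_norm \<omega> g)\<^sup>2 - Re (L2_inner \<omega> f g) - Re (L2_inner \<omega> g f)"
    by (simp add: L2_inner_diff_left f g L2_inner_self del: of_real_power)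
  also have "Re (L2_inner \<omega> g f) = Re (L2_inner \<omega> f g)"
    by (subst L2_inner_cnj[symmetric]) simp
  finally show ?thesis by (simp add: L2_inner_self del: of_real_power)
qed

section \<open>Cauchy-Schwarz and the triangle inequality for representatives\<close>

lemma L2_norm_scale: "L2_norm \<omega> (\<lambda>x. a * f x) = cmod a * L2_norm \<omega> f"
  by (simp add: L2_norm_def norm_mult power_mult_distrib real_sqrt_mult)

text \<open>The square of the norm of \<open>s f - t g\<close> is nonnegative for all
  \<open>s, t \<ge> 0\<close>. If both norms are positive, \<open>s = b\<close> and
  \<open>t = a\<close> give the claim after division by \<open>2 a b\<close>. A zero norm is treated
  separately by taking the factor of that function large.\<close>

lemma L2_Re_inner_le:
  assumes f: "f \<in> L2 \<omega>" and g: "g \<in> L2 \<omega>"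
  shows "Re (L2_inner \<omega> f g) \<le> L2_norm \<omega> f * L2_norm \<omega> g"
proof -
  define a b where "a = L2_norm \<omega> f" and "b = L2_norm \<omega> g"
  have nn: "0 \<le> a" "0 \<le> b" by (auto simp: a_def b_def)
  have *: "2 * (s * t) * Re (L2_inner \<omega> f g) \<le> (s * a)\<^sup>2 + (t * b)\<^sup>2" if "0 \<le> s" "0 \<le> t" for s t :: real
  proof -
    have i: "Re (L2_inner \<omega> (\<lambda>x. of_real s * f x) (\<lambda>x. of_real t * g x)) = s * t * Re (L2_inner \<omega> f g)"
    proof -
      have "L2_inner \<omega> (\<lambda>x. of_real s * f x) (\<lambda>x. of_real t * g x)
          = of_real s * cnj (of_real t * L2_inner \<omega> g f)"
        unfolding L2_inner_scale_left[of \<omega> _ f]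
        by (subst L2_inner_cnj[symmetric]) (simp add: L2_inner_scale_left)
      then show ?thesis by (simp add: L2_inner_cnj)
    qed
    have "0 \<le> (L2_norm \<omega> (\<lambda>x. of_real s * f x - of_real t * g x))\<^sup>2" by simp
    then show ?thesis
      unfolding L2_norm_diff_power2[OF L2_scale[OF f] L2_scale[OF g]] i
      using that by (simp add: L2_norm_scale a_def b_def)
  qed
  show ?thesis
  proof (cases "a = 0 \<or> b = 0")
    case False
    then have ab: "0 < a * b" using nn by simp
    have "2 * (a * b) * Re (L2_inner \<omega> f g) \<le> 2 * (a * b) * (a * b)"
      using *[of b a] nn by (simp add: power2_eq_square algebra_simps)
    then show ?thesis using ab unfolding a_def[symmetric] b_def[symmetric]
      by (subst (asm) mult_le_cancel_left_pos) auto
  next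
    case True
    have "Re (L2_inner \<omega> f g) \<le> 0"
    proof (rule ccontr)
      assume "\<not> ?thesis"
      then have r: "0 < Re (L2_inner \<omega> f g)" (is "0 < ?r") by simp
      consider "a = 0" | "b = 0" using True by auto
      then show False
      proof cases
        case 1
        \<comment> \<open>With \<open>a = 0\<close> the coefficient \<open>s\<close> costs nothing;
          it is chosen so that the left side becomes \<open>2 (b\<^sup>2 + 1)\<close>, more than
          \<open>b\<^sup>2\<close>.\<close>
        then have "2 * ((b\<^sup>2 + 1) / ?r) * ?r \<le> b\<^sup>2" using *[of "(b\<^sup>2 + 1) / ?r" 1] r by simp
        then show False using r zero_le_power2[of b] by simp
      next
        case 2
        then have "2 * ((a\<^sup>2 + 1) / ?r) * ?r \<le> a\<^sup>2" using *[of 1 "(a\<^sup>2 + 1) / ?r"] r by simp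
        then show False using r zero_le_power2[of a] by simp
      qed
    qed
    then show ?thesis using nn by (metis True a_def b_def mult_eq_0_iff)
  qed
qed

lemma L2_Cauchy_Schwarz:
  assumes f: "f \<in> L2 \<omega>" and g: "g \<in> L2 \<omega>"
  shows "cmod (L2_inner \<omega> f g) \<le> L2_norm \<omega> f * L2_norm \<omega> g"
proof (cases "L2_inner \<omega> f g = 0")
  case False
  \<comment> \<open>Rotating \<open>f\<close> by this unimodular factor makes the inner product real
    and nonnegative, so the bound on real parts applies.\<close>
  define s where "s = cnj (sgn (L2_inner \<omega> f g))"
  have s: "cmod s = 1" using False by (simp add: s_def norm_sgn)
  have "s * L2_inner \<omega> f g = complex_of_real (cmod (L2_inner \<omega> f g))"
    using False by (simp add: s_def sgn_div_norm complex_cnj_mult mult.commute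
      complex_norm_square[symmetric] power2_eq_square scaleR_conv_of_real divide_simps)
  then have "cmod (L2_inner \<omega> f g) = Re (L2_inner \<omega> (\<lambda>x. s * f x) g)"
    by (simp add: L2_inner_scale_left)
  also have "\<dots> \<le> L2_norm \<omega> f * L2_norm \<omega> g"
    using L2_Re_inner_le[OF L2_scale[OF f, of s] g] s by (simp add: L2_norm_scale)
  finally show ?thesis .
qed simp

lemma L2_norm_triangle_diff:
  assumes f: "f \<in> L2 \<omega>" and g: "g \<in> L2 \<omega>" and h: "h \<in> L2 \<omega>"
  shows "L2_norm \<omega> (\<lambda>x. f x - h x) \<le> L2_norm \<omega> (\<lambda>x. f x - g x) + L2_norm \<omega> (\<lambda>x. g x - h x)"
proof -
  \<comment> \<open>The sign of \<open>q\<close> makes \<open>p - q = f - h\<close>. The cross term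
    of the expansion is then minus the real part of the inner product of \<open>p\<close> and
    \<open>q\<close>, which is bounded by applying Cauchy-Schwarz to \<open>-p\<close> and
    \<open>q\<close>.\<close>
  define p q where "p = (\<lambda>x. f x - g x)" and "q = (\<lambda>x. h x - g x)"
  have p: "p \<in> L2 \<omega>" and q: "q \<in> L2 \<omega>" and mq: "(\<lambda>x. (-1) * p x) \<in> L2 \<omega>"
    unfolding p_def q_def using f g h by (auto intro!: L2_diff L2_scale simp del: mult_minus1)
  have "(L2_norm \<omega> (\<lambda>x. p x - q x))\<^sup>2 \<le> (L2_norm \<omega> p + L2_norm \<omega> q)\<^sup>2"
    unfolding L2_norm_diff_power2[OF p q] power2_sum
    using L2_Re_inner_le[OF mq q] L2_norm_scale[of \<omega> "-1" p]
    unfolding L2_inner_scale_left by simp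
  then have "L2_norm \<omega> (\<lambda>x. p x - q x) \<le> L2_norm \<omega> p + L2_norm \<omega> q"
    by (rule power2_le_imp_le) simp
  then show ?thesis by (simp add: p_def q_def L2_norm_minus_commute[of \<omega> h g])
qed

subsection \<open>One step of the approximation\<close>

lemma L2_inner_dict_comb:
  assumes \<phi>: "\<And>j. j < n \<Longrightarrow> \<phi> j \<in> L2 \<omega>" and h: "h \<in> L2 \<omega>" and u: "u \<in> carrier_vec n"
  shows "L2_inner \<omega> (dict_comb \<phi> u) h = (\<Sum>k<n. vec_index u k * L2_inner \<omega> (\<phi> k) h)"
    and "L2_inner \<omega> h (dict_comb \<phi> u) = (\<Sum>k<n. cnj (vec_index u k) * L2_inner \<omega> h (\<phi> k))"
proof -
  show *: "L2_inner \<omega> (dict_comb \<phi> u) h = (\<Sum>k<n. vec_index u k * L2_inner \<omega> (\<phi> k) h)"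
    unfolding dict_comb_def using u L2_inner_sum_left[of "{..<n}" "\<lambda>k x. vec_index u k * \<phi> k x" \<omega> h] \<phi> h
    by (simp add: L2_inner_scale_left L2_scale)
  show "L2_inner \<omega> h (dict_comb \<phi> u) = (\<Sum>k<n. cnj (vec_index u k) * L2_inner \<omega> h (\<phi> k))"
    by (subst L2_inner_cnj[symmetric]) (simp add: * L2_inner_cnj)
qed

lemma dict_comb_minus:
  assumes "u \<in> carrier_vec n" "v \<in> carrier_vec n"
  shows "dict_comb \<phi> (u - v) = (\<lambda>x. dict_comb \<phi> u x - dict_comb \<phi> v x)"
  using assms by (auto simp: dict_comb_def sum_subtractf[symmetric] left_diff_distrib)

section \<open>Uniform comparison of matrix forms with forms of operators\<close>

lemma dict_independent_norm_eq_0: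
  assumes ind: "dict_independent \<omega> n \<phi>" and \<phi>: "\<And>j. j < n \<Longrightarrow> \<phi> j \<in> L2 \<omega>"
    and u: "u \<in> carrier_vec n" and z: "L2_norm \<omega> (dict_comb \<phi> u) = 0"
  shows "u = 0\<^sub>v n"
  using ind u L2_norm_eq_0_AE[OF L2_dict_comb[OF \<phi> u] z] by (auto simp: dict_independent_def)

text \<open>Linear independence makes the Gram matrix \<open>G\<close> invertible. Hence
  \<open>u = B (G u)\<close> for its inverse \<open>B\<close>, and the entries of \<open>G u\<close>
  are inner products of \<open>dict_comb \<phi> u\<close> with the dictionary, to which
  Cauchy-Schwarz applies. This turns entrywise convergence into estimates uniform in the coefficient
  vectors.\<close>

lemma coordinates_bounded:
  assumes ind: "dict_independent \<omega> n \<phi>" and \<phi>: "\<And>j. j < n \<Longrightarrow> \<phi> j \<in> L2 \<omega>"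
  obtains C where "0 < C"
    "\<And>u k. u \<in> carrier_vec n \<Longrightarrow> k < n \<Longrightarrow> cmod (vec_index u k) \<le> C * L2_norm \<omega> (dict_comb \<phi> u)"
proof -
  define G where "G = Matrix.mat n n (\<lambda>(j, k). L2_inner \<omega> (\<phi> k) (\<phi> j))"
  have G: "G \<in> carrier_mat n n" by (simp add: G_def)
  have Gu: "vec_index (G *\<^sub>v u) j = L2_inner \<omega> (dict_comb \<phi> u) (\<phi> j)"
    if "u \<in> carrier_vec n" "j < n" for u j
  proof -
    have "L2_inner \<omega> (dict_comb \<phi> u) (\<phi> j) = (\<Sum>k<n. vec_index u k * L2_inner \<omega> (\<phi> k) (\<phi> j))"
      using that \<phi> by (intro L2_inner_dict_comb) auto
    then show ?thesis
      using that by (simp add: G_def scalar_prod_def atLeast0LessThan mult.commute)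
  qed
  obtain B where B: "B \<in> carrier_mat n n" "B * G = 1\<^sub>m n"
  proof (rule invertible_mat_if_trivial_kernel[OF G])
    fix v :: "complex Matrix.vec"
    assume v: "v \<in> carrier_vec n" and 0: "G *\<^sub>v v = 0\<^sub>v n"
    have "L2_inner \<omega> (dict_comb \<phi> v) (dict_comb \<phi> v)
        = (\<Sum>k<n. cnj (vec_index v k) * L2_inner \<omega> (dict_comb \<phi> v) (\<phi> k))"
      by (rule L2_inner_dict_comb(2)[OF _ L2_dict_comb[of n]]) (use \<phi> v in auto)
    also have "\<dots> = 0"
      using Gu[OF v] 0 by (intro sum.neutral) auto
    finally have "L2_inner \<omega> (dict_comb \<phi> v) (dict_comb \<phi> v) = 0" .
    then show "v = 0\<^sub>v n"
      by (intro dict_independent_norm_eq_0[OF ind \<phi> v]) (auto simp: L2_inner_self simp del: of_real_power)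
  qed
  \<comment> \<open>The summand \<open>1\<close> keeps \<open>C\<close> positive for the empty
    dictionary as well.\<close>
  define C where "C = (\<Sum>k<n. \<Sum>j<n. cmod (B $$ (k, j)) * L2_norm \<omega> (\<phi> j)) + 1"
  have "0 < C" unfolding C_def by (intro add_nonneg_pos sum_nonneg) auto
  moreover have "cmod (vec_index u k) \<le> C * L2_norm \<omega> (dict_comb \<phi> u)"
    if u: "u \<in> carrier_vec n" and k: "k < n" for u k
  proof -
    have "u = B *\<^sub>v (G *\<^sub>v u)"
      using assoc_mult_mat_vec[OF B(1) G u] B u by simp
    then have "vec_index u k = vec_index (B *\<^sub>v (G *\<^sub>v u)) k" by simp
    also have "\<dots> = (\<Sum>j<n. B $$ (k, j) * vec_index (G *\<^sub>v u) j)"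
      using B G u k by (simp add: scalar_prod_def atLeast0LessThan)
    also have "\<dots> = (\<Sum>j<n. B $$ (k, j) * L2_inner \<omega> (dict_comb \<phi> u) (\<phi> j))"
      by (intro sum.cong refl) (simp add: Gu[OF u])
    also have "cmod \<dots> \<le> (\<Sum>j<n. cmod (B $$ (k, j)) * (L2_norm \<omega> (dict_comb \<phi> u) * L2_norm \<omega> (\<phi> j)))"
      by (intro sum_norm_le) (auto simp: norm_mult intro!: mult_left_mono L2_Cauchy_Schwarz L2_dict_comb \<phi> u)
    also have "\<dots> = (\<Sum>j<n. cmod (B $$ (k, j)) * L2_norm \<omega> (\<phi> j)) * L2_norm \<omega> (dict_comb \<phi> u)"
      unfolding sum_distrib_right by (simp add: mult_ac)
    also have "\<dots> \<le> C * L2_norm \<omega> (dict_comb \<phi> u)"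
    proof (rule mult_right_mono)
      have "(\<Sum>j<n. cmod (B $$ (k, j)) * L2_norm \<omega> (\<phi> j))
          \<le> (\<Sum>k<n. \<Sum>j<n. cmod (B $$ (k, j)) * L2_norm \<omega> (\<phi> j))"
        by (rule member_le_sum) (use k in \<open>auto intro: sum_nonneg\<close>)
      then show "(\<Sum>j<n. cmod (B $$ (k, j)) * L2_norm \<omega> (\<phi> j)) \<le> C" by (simp add: C_def)
    qed simp
    finally show ?thesis .
  qed
  ultimately show thesis by (rule that)
qed

text \<open>Uniformity in the coefficient vectors is essential: for fixed \<open>N\<close> the matrices \<open>\<bbbK>\<close> need not
  converge as \<open>M \<rightarrow> \<infinity>\<close>, since the singular value decomposition is not unique.\<close>

definition form_close ::
  "'a measure \<Rightarrow> nat \<Rightarrow> (nat \<Rightarrow> 'a \<Rightarrow> complex) \<Rightarrow> (('a \<Rightarrow> complex) \<Rightarrow> ('a \<Rightarrow> complex)) \<Rightarrow>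
     complex mat \<Rightarrow> real \<Rightarrow> bool" where
  "form_close \<omega> n \<phi> T B \<epsilon> \<longleftrightarrow>
     (\<forall>u\<in>carrier_vec n. \<forall>v\<in>carrier_vec n.
        cmod ((B *\<^sub>v u) \<bullet>c v - L2_inner \<omega> (T (dict_comb \<phi> u)) (dict_comb \<phi> v))
          \<le> \<epsilon> * (L2_norm \<omega> (dict_comb \<phi> u) * L2_norm \<omega> (dict_comb \<phi> v)))"

text \<open>The finitely many entries are close to their limits simultaneously from some
  \<open>M\<close> on. The error in the form is a sum over entries, and the coordinate bound
  converts it into one relative to the two norms.\<close>

lemma eventually_form_close:
  fixes B :: "nat \<Rightarrow> complex mat"
  assumes ind: "dict_independent \<omega> n \<phi>" and \<phi>: "\<And>j. j < n \<Longrightarrow> \<phi> j \<in> L2 \<omega>"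
    and T: "\<And>j. j < n \<Longrightarrow> T (\<phi> j) \<in> L2 \<omega>"
    and T_lin: "\<And>u. u \<in> carrier_vec n \<Longrightarrow> T (dict_comb \<phi> u) = dict_comb (\<lambda>j. T (\<phi> j)) u"
    and B: "\<And>M. B M \<in> carrier_mat n n"
    and lim: "\<And>j k. j < n \<Longrightarrow> k < n \<Longrightarrow> (\<lambda>M. B M $$ (j, k)) \<longlonglongrightarrow> L2_inner \<omega> (T (\<phi> k)) (\<phi> j)"
    and \<epsilon>: "0 < \<epsilon>"
  shows "\<forall>\<^sub>F M in sequentially. form_close \<omega> n \<phi> T (B M) \<epsilon>"
proof -
  obtain C where C: "0 < C"
    and bound: "\<And>u k. u \<in> carrier_vec n \<Longrightarrow> k < n \<Longrightarrow> cmod (vec_index u k) \<le> C * L2_norm \<omega> (dict_comb \<phi> u)"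
    using coordinates_bounded[OF ind \<phi>] by metis
  define b where "b j k = L2_inner \<omega> (T (\<phi> k)) (\<phi> j)" for j k
  \<comment> \<open>There are \<open>n * n\<close> summands, each at most \<delta> times
    \<open>C\<^sup>2\<close> times the two norms; the extra \<open>1\<close> permits division when
    \<open>n = 0\<close>.\<close>
  define r where "r = real n * (real n * C\<^sup>2) + 1"
  have r: "0 < r" unfolding r_def by (intro add_nonneg_pos) auto
  define \<delta> where "\<delta> = \<epsilon> / r"
  have \<delta>: "0 < \<delta>" using r \<epsilon> by (simp add: \<delta>_def)
  have "\<forall>\<^sub>F M in sequentially. \<forall>j\<in>{..<n}. \<forall>k\<in>{..<n}. cmod (B M $$ (j, k) - b j k) < \<delta>"
    using lim \<delta> by (intro eventually_ball_finite ballI) (auto simp: b_def tendsto_iff dist_norm)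
  then show ?thesis
  proof eventually_elim
    case (elim M)
    show ?case
      unfolding form_close_def
    proof (intro ballI)
      fix u v :: "complex Matrix.vec"
      assume u: "u \<in> carrier_vec n" and v: "v \<in> carrier_vec n"
      define a c where "a = L2_norm \<omega> (dict_comb \<phi> u)" and "c = L2_norm \<omega> (dict_comb \<phi> v)"
      have ac: "0 \<le> a" "0 \<le> c" by (auto simp: a_def c_def)
      have "L2_inner \<omega> (T (dict_comb \<phi> u)) (dict_comb \<phi> v)
          = (\<Sum>j<n. cnj (vec_index v j) * L2_inner \<omega> (dict_comb (\<lambda>j. T (\<phi> j)) u) (\<phi> j))"
        unfolding T_lin[OF u] by (intro L2_inner_dict_comb(2) L2_dict_comb[where n=n] \<phi> T u v)
      also have "\<dots> = (\<Sum>j<n. cnj (vec_index v j) * (\<Sum>k<n. vec_index u k * b j k))"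
        unfolding b_def
        by (intro sum.cong refl arg_cong2[where f="(*)"] L2_inner_dict_comb(1) T u) (simp_all add: \<phi>)
      also have "\<dots> = (\<Sum>j<n. \<Sum>k<n. b j k * vec_index u k * cnj (vec_index v j))"
        by (simp add: sum_distrib_left mult_ac)
      finally have "(B M *\<^sub>v u) \<bullet>c v - L2_inner \<omega> (T (dict_comb \<phi> u)) (dict_comb \<phi> v)
          = (\<Sum>j<n. \<Sum>k<n. (B M $$ (j, k) - b j k) * vec_index u k * cnj (vec_index v j))"
        unfolding cscalar_prod_sum[OF B u v] by (simp add: sum_subtractf left_diff_distrib)
      also have "cmod \<dots> \<le> (\<Sum>j<n. \<Sum>k<n. \<delta> * (C * a) * (C * c))"
      proof (intro sum_norm_le)
        fix j k assume "j \<in> {..<n}" "k \<in> {..<n}"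
        then have j: "j < n" and k: "k < n" by auto
        show "cmod ((B M $$ (j, k) - b j k) * vec_index u k * cnj (vec_index v j)) \<le> \<delta> * (C * a) * (C * c)"
          unfolding norm_mult complex_mod_cnj a_def c_def
          using elim j k \<delta> C bound[OF u k] bound[OF v j]
          by (intro mult_mono) (auto simp: less_imp_le)
      qed
      also have "\<dots> = \<delta> * (real n * (real n * C\<^sup>2)) * (a * c)"
        by (simp add: power2_eq_square)
      also have "\<dots> \<le> \<epsilon> * (a * c)"
      proof (rule mult_right_mono)
        have "\<delta> * (real n * (real n * C\<^sup>2)) \<le> \<delta> * r" using \<delta> by (simp add: r_def)
        also have "\<dots> = \<epsilon>" using r by (simp add: \<delta>_def)
        finally show "\<delta> * (real n * (real n * C\<^sup>2)) \<le> \<epsilon>" .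
      qed (use ac in simp)
      finally show "cmod ((B M *\<^sub>v u) \<bullet>c v - L2_inner \<omega> (T (dict_comb \<phi> u)) (dict_comb \<phi> v))
          \<le> \<epsilon> * (L2_norm \<omega> (dict_comb \<phi> u) * L2_norm \<omega> (dict_comb \<phi> v))"
        by (simp add: a_def c_def)
    qed
  qed
qed

text \<open>On a kernel vector the matrix form vanishes, so the squared norm is at most \<epsilon>
  times itself and must be zero. This makes the mpEDMD construction available for all large
  \<open>M\<close>.\<close>

lemma form_close_invertible:
  assumes ind: "dict_independent \<omega> n \<phi>" and \<phi>: "\<And>j. j < n \<Longrightarrow> \<phi> j \<in> L2 \<omega>"
    and G: "G \<in> carrier_mat n n" and close: "form_close \<omega> n \<phi> (\<lambda>f. f) G \<epsilon>" and \<epsilon>: "\<epsilon> < 1"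
  shows "invertible_mat G"
proof (rule invertible_mat_if_trivial_kernel[OF G])
  fix v :: "complex Matrix.vec"
  assume v: "v \<in> carrier_vec n" and 0: "G *\<^sub>v v = 0\<^sub>v n"
  define a where "a = L2_norm \<omega> (dict_comb \<phi> v)"
  have "(G *\<^sub>v v) \<bullet>c v = 0" using 0 v by simp
  then have "cmod (L2_inner \<omega> (dict_comb \<phi> v) (dict_comb \<phi> v)) \<le> \<epsilon> * (a * a)"
    using close v by (force simp: form_close_def a_def)
  then have "a\<^sup>2 \<le> \<epsilon> * a\<^sup>2"
    unfolding L2_inner_self norm_of_real by (simp add: a_def power2_eq_square)
  then have "(1 - \<epsilon>) * a\<^sup>2 \<le> 0" by (simp add: algebra_simps)
  then have "a\<^sup>2 \<le> 0" using \<epsilon> by (simp add: mult_le_0_iff)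
  then show "v = 0\<^sub>v n"
    by (intro dict_independent_norm_eq_0[OF ind \<phi> v]) (auto simp: a_def)
qed

text \<open>Passing to adjoints exchanges \<open>u\<close> and \<open>v\<close> and conjugates the
  difference, and the error bound is symmetric in \<open>u\<close> and \<open>v\<close>.\<close>

lemma form_close_adjoint:
  assumes B: "B \<in> carrier_mat n n" and close: "form_close \<omega> n \<phi> T B \<epsilon>"
    and \<phi>: "\<And>j. j < n \<Longrightarrow> \<phi> j \<in> L2 \<omega>" and adj: "L2_adjoint \<omega> T T'"
  shows "form_close \<omega> n \<phi> T' (mat_adjoint B) \<epsilon>"
  unfolding form_close_def
proof (intro ballI)
  fix u v :: "complex Matrix.vec"
  assume u: "u \<in> carrier_vec n" and v: "v \<in> carrier_vec n"
  have "dict_comb \<phi> u \<in> L2 \<omega>" "dict_comb \<phi> v \<in> L2 \<omega>"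
    by (rule L2_dict_comb[OF \<phi>]; use u v in simp)+
  then have "L2_inner \<omega> (T (dict_comb \<phi> v)) (dict_comb \<phi> u) = L2_inner \<omega> (dict_comb \<phi> v) (T' (dict_comb \<phi> u))"
    using adj by (simp add: L2_adjoint_def)
  then have "L2_inner \<omega> (T' (dict_comb \<phi> u)) (dict_comb \<phi> v)
      = cnj (L2_inner \<omega> (T (dict_comb \<phi> v)) (dict_comb \<phi> u))"
    by (simp add: L2_inner_cnj)
  then have "(mat_adjoint B *\<^sub>v u) \<bullet>c v - L2_inner \<omega> (T' (dict_comb \<phi> u)) (dict_comb \<phi> v)
      = cnj ((B *\<^sub>v v) \<bullet>c u - L2_inner \<omega> (T (dict_comb \<phi> v)) (dict_comb \<phi> u))"
    unfolding cscalar_prod_adjoint[OF B v u] complex_cnj_diff by simp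
  then show "cmod ((mat_adjoint B *\<^sub>v u) \<bullet>c v - L2_inner \<omega> (T' (dict_comb \<phi> u)) (dict_comb \<phi> v))
      \<le> \<epsilon> * (L2_norm \<omega> (dict_comb \<phi> u) * L2_norm \<omega> (dict_comb \<phi> v))"
    using close[unfolded form_close_def, rule_format, OF v u]
    by (simp only: complex_mod_cnj mult.commute[of "L2_norm \<omega> (dict_comb \<phi> u)"])
qed

section \<open>Error estimates for a single application of a polar factor\<close>

lemma form_close_Re:
  assumes "form_close \<omega> n \<phi> T B \<epsilon>" "u \<in> carrier_vec n" "v \<in> carrier_vec n"
  shows "\<bar>Re ((B *\<^sub>v u) \<bullet>c v) - Re (L2_inner \<omega> (T (dict_comb \<phi> u)) (dict_comb \<phi> v))\<bar>
    \<le> \<epsilon> * (L2_norm \<omega> (dict_comb \<phi> u) * L2_norm \<omega> (dict_comb \<phi> v))"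
  using assms abs_Re_le_cmod[of "(B *\<^sub>v u) \<bullet>c v - L2_inner \<omega> (T (dict_comb \<phi> u)) (dict_comb \<phi> v)"]
  unfolding form_close_def minus_complex.sel by (meson order_trans)

text \<open>\<open>Q\<close> preserves the form of \<open>G\<close> exactly, and this form agrees
  with the squared norm up to a relative error \<epsilon>, both at \<open>u\<close> and at
  \<open>Q u\<close>.\<close>

lemma polar_factor_almost_isometry:
  assumes P: "polar_factor n G B Q" and G: "G \<in> carrier_mat n n"
    and close: "form_close \<omega> n \<phi> (\<lambda>f. f) G \<epsilon>" and \<epsilon>: "0 \<le> \<epsilon>" "\<epsilon> \<le> 1/2" and u: "u \<in> carrier_vec n"
  shows "(L2_norm \<omega> (dict_comb \<phi> (Q *\<^sub>v u)))\<^sup>2 \<le> (1 + 4 * \<epsilon>) * (L2_norm \<omega> (dict_comb \<phi> u))\<^sup>2"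
    and "(L2_norm \<omega> (dict_comb \<phi> u))\<^sup>2 \<le> (1 + 4 * \<epsilon>) * (L2_norm \<omega> (dict_comb \<phi> (Q *\<^sub>v u)))\<^sup>2"
proof -
  have Q: "Q \<in> carrier_mat n n" and QGQ: "mat_adjoint Q * G * Q = G"
    using P by (auto simp: polar_factor_def)
  have Qu: "Q *\<^sub>v u \<in> carrier_vec n" using Q u by simp
  define a t where "a = L2_norm \<omega> (dict_comb \<phi> u)" and "t = L2_norm \<omega> (dict_comb \<phi> (Q *\<^sub>v u))"
  have "(G *\<^sub>v u) \<bullet>c u = ((mat_adjoint Q * (G * Q)) *\<^sub>v u) \<bullet>c u"
    using QGQ assoc_mult_mat[OF mat_adjoint_carrier[OF Q] G Q] by simp
  also have "\<dots> = (G *\<^sub>v (Q *\<^sub>v u)) \<bullet>c (Q *\<^sub>v u)"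
    using cscalar_prod_adjoint_mult[OF mult_carrier_mat[OF G Q] Q u u] G Q u by simp
  finally have e: "(G *\<^sub>v u) \<bullet>c u = (G *\<^sub>v (Q *\<^sub>v u)) \<bullet>c (Q *\<^sub>v u)" .
  have "\<bar>Re ((G *\<^sub>v u) \<bullet>c u) - a\<^sup>2\<bar> \<le> \<epsilon> * a\<^sup>2" "\<bar>Re ((G *\<^sub>v u) \<bullet>c u) - t\<^sup>2\<bar> \<le> \<epsilon> * t\<^sup>2"
    using form_close_Re[OF close u u] form_close_Re[OF close Qu Qu] e
    by (auto simp: L2_inner_self a_def t_def power2_eq_square)
  then have 1: "(1 - \<epsilon>) * t\<^sup>2 \<le> (1 + \<epsilon>) * a\<^sup>2" "(1 - \<epsilon>) * a\<^sup>2 \<le> (1 + \<epsilon>) * t\<^sup>2"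
    by (simp_all add: algebra_simps)
  have "\<epsilon> * \<epsilon> \<le> \<epsilon> * (1/2)" using \<epsilon> by (intro mult_left_mono) auto
  \<comment> \<open>The ratio of \<open>1 + \<epsilon>\<close> to \<open>1 - \<epsilon>\<close> is
    at most \<open>1 + 4 * \<epsilon>\<close>; this is where \<epsilon> at most \<open>1/2\<close>
    enters.\<close>
  then have 2: "1 + \<epsilon> \<le> (1 - \<epsilon>) * (1 + 4 * \<epsilon>)" by (simp add: algebra_simps)
  have "y \<le> (1 + 4 * \<epsilon>) * z" if "(1 - \<epsilon>) * y \<le> (1 + \<epsilon>) * z" "0 \<le> z" for y z
  proof -
    have "(1 - \<epsilon>) * y \<le> (1 - \<epsilon>) * ((1 + 4 * \<epsilon>) * z)"
      using mult_right_mono[OF 2 that(2)] that(1) by (simp add: mult.assoc)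
    then show ?thesis using \<epsilon> by simp
  qed
  from this[OF 1(1)] this[OF 1(2)] show
    "(L2_norm \<omega> (dict_comb \<phi> (Q *\<^sub>v u)))\<^sup>2 \<le> (1 + 4 * \<epsilon>) * (L2_norm \<omega> (dict_comb \<phi> u))\<^sup>2"
    "(L2_norm \<omega> (dict_comb \<phi> u))\<^sup>2 \<le> (1 + 4 * \<epsilon>) * (L2_norm \<omega> (dict_comb \<phi> (Q *\<^sub>v u)))\<^sup>2"
    by (auto simp: a_def t_def)
qed

text \<open>Ignoring terms of order \<epsilon>, the squared error at \<open>Q u\<close> is
  \<open>2 a\<^sup>2 - 2 p\<close>. Positivity at \<open>u - w\<close> with \<open>Q w = v\<close>
  gives \<open>2 Re (B u, v) \<le> p + Re (B w, v)\<close>, and the last term is at most about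
  \<open>b\<^sup>2\<close> by Cauchy-Schwarz and the isometry properties of \<open>T\<close> and
  \<open>Q\<close>. Thus the squared error is at most
  \<open>2 (a\<^sup>2 + b\<^sup>2 - 2 Re (B u, v))\<close>, which is about
  \<open>2 d\<^sup>2\<close>.\<close>

lemma polar_factor_step:
  assumes P: "polar_factor n G B Q" and G: "G \<in> carrier_mat n n" and B: "B \<in> carrier_mat n n"
    and \<phi>: "\<And>j. j < n \<Longrightarrow> \<phi> j \<in> L2 \<omega>"
    and T: "\<And>f. f \<in> L2 \<omega> \<Longrightarrow> T f \<in> L2 \<omega>" and iso: "\<And>f. f \<in> L2 \<omega> \<Longrightarrow> L2_norm \<omega> (T f) = L2_norm \<omega> f"
    and closeG: "form_close \<omega> n \<phi> (\<lambda>f. f) G \<epsilon>" and closeB: "form_close \<omega> n \<phi> T B \<epsilon>"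
    and \<epsilon>: "0 \<le> \<epsilon>" "\<epsilon> \<le> 1/2" and u: "u \<in> carrier_vec n" and v: "v \<in> carrier_vec n"
  shows "(L2_norm \<omega> (\<lambda>z. T (dict_comb \<phi> u) z - dict_comb \<phi> (Q *\<^sub>v u) z))\<^sup>2
    \<le> 2 * (L2_norm \<omega> (\<lambda>z. T (dict_comb \<phi> u) z - dict_comb \<phi> v z))\<^sup>2
      + 10 * \<epsilon> * ((L2_norm \<omega> (dict_comb \<phi> u))\<^sup>2 + (L2_norm \<omega> (dict_comb \<phi> v))\<^sup>2)"
proof -
  obtain L where Q: "Q \<in> carrier_mat n n" and L: "L \<in> carrier_mat n n" "Q * L = 1\<^sub>m n"
    using P by (auto simp: polar_factor_def)
  \<comment> \<open>The preimage of \<open>v\<close> under \<open>Q\<close>, so that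
    \<open>v\<close> itself appears in the second argument of the positive form.\<close>
  define w where "w = L *\<^sub>v v"
  have w: "w \<in> carrier_vec n" using L v by (simp add: w_def)
  have Qw: "Q *\<^sub>v w = v"
    unfolding w_def using assoc_mult_mat_vec[OF Q L(1) v] L v by simp
  have Qu: "Q *\<^sub>v u \<in> carrier_vec n" using Q u by simp
  have mem: "dict_comb \<phi> y \<in> L2 \<omega>" if "y \<in> carrier_vec n" for y
    by (rule L2_dict_comb[OF \<phi> that])
  define a b s t d where "a = L2_norm \<omega> (dict_comb \<phi> u)" and "b = L2_norm \<omega> (dict_comb \<phi> v)"
    and "s = L2_norm \<omega> (dict_comb \<phi> w)" and "t = L2_norm \<omega> (dict_comb \<phi> (Q *\<^sub>v u))"
    and "d = L2_norm \<omega> (\<lambda>z. T (dict_comb \<phi> u) z - dict_comb \<phi> v z)"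
  define p where "p = Re ((B *\<^sub>v u) \<bullet>c (Q *\<^sub>v u))"
  have nn: "0 \<le> a" "0 \<le> b" "0 \<le> s" "0 \<le> t" by (auto simp: a_def b_def s_def t_def)
  have t2: "t\<^sup>2 \<le> (1 + 4 * \<epsilon>) * a\<^sup>2" and s2: "s\<^sup>2 \<le> (1 + 4 * \<epsilon>) * b\<^sup>2"
    using polar_factor_almost_isometry[OF P G closeG \<epsilon> u] polar_factor_almost_isometry[OF P G closeG \<epsilon> w]
    by (auto simp: a_def b_def s_def t_def Qw)
  have opt: "2 * Re ((B *\<^sub>v u) \<bullet>c v) \<le> p + Re ((B *\<^sub>v w) \<bullet>c v)"
    using polar_factor_optimal[OF P B u w] by (simp add: Qw p_def)
  have 1: "\<bar>p - Re (L2_inner \<omega> (T (dict_comb \<phi> u)) (dict_comb \<phi> (Q *\<^sub>v u)))\<bar> \<le> \<epsilon> * (a * t)"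
    unfolding p_def a_def t_def by (rule form_close_Re[OF closeB u Qu])
  have 2: "\<bar>Re ((B *\<^sub>v u) \<bullet>c v) - Re (L2_inner \<omega> (T (dict_comb \<phi> u)) (dict_comb \<phi> v))\<bar> \<le> \<epsilon> * (a * b)"
    unfolding b_def a_def by (rule form_close_Re[OF closeB u v])
  have 3: "\<bar>Re ((B *\<^sub>v w) \<bullet>c v) - Re (L2_inner \<omega> (T (dict_comb \<phi> w)) (dict_comb \<phi> v))\<bar> \<le> \<epsilon> * (s * b)"
    unfolding b_def s_def by (rule form_close_Re[OF closeB w v])
  have 4: "Re (L2_inner \<omega> (T (dict_comb \<phi> w)) (dict_comb \<phi> v)) \<le> s * b"
    using L2_Re_inner_le[OF T[OF mem[OF w]] mem[OF v]] iso[OF mem[OF w]] by (simp add: s_def b_def)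
  have 5: "d\<^sup>2 = a\<^sup>2 + b\<^sup>2 - 2 * Re (L2_inner \<omega> (T (dict_comb \<phi> u)) (dict_comb \<phi> v))"
    unfolding d_def L2_norm_diff_power2[OF T[OF mem[OF u]] mem[OF v]]
    by (simp add: iso[OF mem[OF u]] a_def b_def)
  have 6: "(L2_norm \<omega> (\<lambda>z. T (dict_comb \<phi> u) z - dict_comb \<phi> (Q *\<^sub>v u) z))\<^sup>2
      = a\<^sup>2 + t\<^sup>2 - 2 * Re (L2_inner \<omega> (T (dict_comb \<phi> u)) (dict_comb \<phi> (Q *\<^sub>v u)))"
    unfolding L2_norm_diff_power2[OF T[OF mem[OF u]] mem[OF Qu]]
    by (simp add: iso[OF mem[OF u]] a_def t_def)
  have *: "y * z \<le> (1 + 2 * \<epsilon>) * z\<^sup>2" "y * z \<le> 2 * z\<^sup>2" if "y\<^sup>2 \<le> (1 + 4 * \<epsilon>) * z\<^sup>2" for y z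
  proof -
    have "2 * (y * z) \<le> y\<^sup>2 + z\<^sup>2" using sum_squares_bound[of y z] by simp
    then show 1: "y * z \<le> (1 + 2 * \<epsilon>) * z\<^sup>2" using that by (simp add: algebra_simps)
    have "(1 + 2 * \<epsilon>) * z\<^sup>2 \<le> 2 * z\<^sup>2" using \<epsilon> by (intro mult_right_mono) auto
    with 1 show "y * z \<le> 2 * z\<^sup>2" by simp
  qed
  have sb: "s * b \<le> b\<^sup>2 + 2 * (\<epsilon> * b\<^sup>2)" using *(1)[OF s2] by (simp add: algebra_simps)
  have esb: "\<epsilon> * (s * b) \<le> 2 * (\<epsilon> * b\<^sup>2)" using mult_left_mono[OF *(2)[OF s2] \<epsilon>(1)] by simp
  have eat: "\<epsilon> * (a * t) \<le> 2 * (\<epsilon> * a\<^sup>2)"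
    using mult_left_mono[OF *(2)[OF t2] \<epsilon>(1)] by (simp add: mult.commute)
  have eab: "2 * (\<epsilon> * (a * b)) \<le> \<epsilon> * a\<^sup>2 + \<epsilon> * b\<^sup>2"
    using mult_left_mono[OF sum_squares_bound[of a b] \<epsilon>(1)] by (simp add: algebra_simps)
  have t2': "t\<^sup>2 \<le> a\<^sup>2 + 4 * (\<epsilon> * a\<^sup>2)" using t2 by (simp add: algebra_simps)
  \<comment> \<open>The constant \<open>10\<close> is \<open>4 + 4 + 2\<close> for each norm: for
    \<open>a\<^sup>2\<close> from \<open>t2'\<close>, \<open>eat\<close> and \<open>eab\<close>, and
    for \<open>b\<^sup>2\<close> from \<open>sb\<close>, \<open>esb\<close> and
    \<open>eab\<close>.\<close>
  have "a\<^sup>2 + t\<^sup>2 - 2 * Re (L2_inner \<omega> (T (dict_comb \<phi> u)) (dict_comb \<phi> (Q *\<^sub>v u)))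
      \<le> 2 * d\<^sup>2 + 10 * (\<epsilon> * a\<^sup>2) + 10 * (\<epsilon> * b\<^sup>2)"
    using abs_le_D2[OF 1] abs_le_D1[OF 1] abs_le_D2[OF 2] abs_le_D1[OF 3] 4 5 opt sb esb eat eab t2'
    by linarith
  then show ?thesis unfolding 6 by (simp add: a_def b_def d_def algebra_simps)
qed

text \<open>A Lipschitz constant independent of \<epsilon> and of the dictionary, used to carry the
  error of the previous iterate through \<open>Q\<close>.\<close>

lemma polar_factor_norm_le:
  assumes P: "polar_factor n G B Q" and G: "G \<in> carrier_mat n n"
    and close: "form_close \<omega> n \<phi> (\<lambda>f. f) G \<epsilon>" and \<epsilon>: "0 \<le> \<epsilon>" "\<epsilon> \<le> 1/2" and u: "u \<in> carrier_vec n"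
  shows "L2_norm \<omega> (dict_comb \<phi> (Q *\<^sub>v u)) \<le> 2 * L2_norm \<omega> (dict_comb \<phi> u)"
proof (rule power2_le_imp_le)
  have "(L2_norm \<omega> (dict_comb \<phi> (Q *\<^sub>v u)))\<^sup>2 \<le> (1 + 4 * \<epsilon>) * (L2_norm \<omega> (dict_comb \<phi> u))\<^sup>2"
    by (rule polar_factor_almost_isometry(1)[OF assms])
  also have "\<dots> \<le> 4 * (L2_norm \<omega> (dict_comb \<phi> u))\<^sup>2"
    using \<epsilon> by (intro mult_right_mono) auto
  finally show "(L2_norm \<omega> (dict_comb \<phi> (Q *\<^sub>v u)))\<^sup>2 \<le> (2 * L2_norm \<omega> (dict_comb \<phi> u))\<^sup>2"
    by (simp add: power_mult_distrib)
qed simp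

subsection \<open>Iteration\<close>

text \<open>Matrix powers unfold with the new factor on the right, whereas the iteration applies it
  on the left.\<close>

lemma pow_mat_Suc_left:
  fixes A :: "'b::semiring_1 mat"
  assumes A: "A \<in> carrier_mat n n"
  shows "A ^\<^sub>m Suc k = A * A ^\<^sub>m k"
proof (induction k)
  case (Suc k)
  have "A ^\<^sub>m Suc (Suc k) = A * A ^\<^sub>m k * A" using Suc by simp
  also have "\<dots> = A * A ^\<^sub>m Suc k" using A by (simp add: assoc_mult_mat[of _ n n _ n _ n])
  finally show ?case .
qed (use A in simp)

lemma eventually_dict_approximation:
  assumes "(\<lambda>N. L2_dist \<omega> h (dict_span N (\<psi> N))) \<longlonglongrightarrow> 0" "0 < \<delta>"
  shows "\<forall>\<^sub>F N in sequentially. \<exists>u\<in>carrier_vec N. L2_norm \<omega> (\<lambda>z. h z - dict_comb (\<psi> N) u z) < \<delta>"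
  using order_tendstoD(2)[OF assms]
proof eventually_elim
  case (elim N)
  have "dict_span N (\<psi> N) \<noteq> {}" unfolding dict_span_def image_is_empty using zero_carrier_vec by blast
  moreover have "bdd_below ((\<lambda>f. L2_norm \<omega> (\<lambda>x. h x - f x)) ` dict_span N (\<psi> N))"
    by (rule bdd_belowI[of _ 0]) auto
  ultimately show ?case
    using elim by (auto simp: L2_dist_def cINF_less_iff dict_span_def)
qed

text \<open>In the induction step the path from \<open>T\<^sup>l\<^sup>+\<^sup>1 g\<close> to the
  next iterate runs through \<open>T (\<Psi> u)\<close> and \<open>\<Psi> (Q u)\<close>, where
  \<open>u\<close> and \<open>v\<close> give approximants of \<open>T\<^sup>l g\<close> and
  \<open>T\<^sup>l\<^sup>+\<^sup>1 g\<close> in the span. The operator \<open>T\<close> stands for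
  both the Koopman operator and its adjoint; its isometry is stated for differences because an
  adjoint acting on representatives need not be pointwise linear.\<close>

lemma polar_iterates_error:
  fixes Q G B :: "nat \<Rightarrow> nat \<Rightarrow> complex mat"
  assumes \<psi>: "\<And>N j. j < N \<Longrightarrow> \<psi> N j \<in> L2 \<omega>"
    and dense: "\<And>h. h \<in> L2 \<omega> \<Longrightarrow> (\<lambda>N. L2_dist \<omega> h (dict_span N (\<psi> N))) \<longlonglongrightarrow> 0"
    and T: "\<And>f. f \<in> L2 \<omega> \<Longrightarrow> T f \<in> L2 \<omega>"
    and norm_T: "\<And>f. f \<in> L2 \<omega> \<Longrightarrow> L2_norm \<omega> (T f) = L2_norm \<omega> f"
    and dist_T: "\<And>f h. f \<in> L2 \<omega> \<Longrightarrow> h \<in> L2 \<omega> \<Longrightarrow>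
      L2_norm \<omega> (\<lambda>z. T f z - T h z) = L2_norm \<omega> (\<lambda>z. f z - h z)"
    and G: "\<And>N M. G N M \<in> carrier_mat N N" and B: "\<And>N M. B N M \<in> carrier_mat N N"
    and close: "\<And>N \<epsilon>. 0 < \<epsilon> \<Longrightarrow> \<forall>\<^sub>F M in sequentially. polar_factor N (G N M) (B N M) (Q N M)
      \<and> form_close \<omega> N (\<psi> N) (\<lambda>f. f) (G N M) \<epsilon> \<and> form_close \<omega> N (\<psi> N) T (B N M) \<epsilon>"
    and g: "g \<in> L2 \<omega>" and c: "\<And>N. c N \<in> carrier_vec N"
    and conv: "(\<lambda>N. L2_norm \<omega> (\<lambda>z. g z - dict_comb (\<psi> N) (c N) z)) \<longlonglongrightarrow> 0"
    and \<eta>: "0 < \<eta>"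
  shows "\<forall>\<^sub>F N in sequentially. \<forall>\<^sub>F M in sequentially.
    L2_norm \<omega> (\<lambda>z. (T ^^ l) g z - dict_comb (\<psi> N) ((Q N M ^\<^sub>m l) *\<^sub>v c N) z) \<le> \<eta>"
  using \<eta>
proof (induction l arbitrary: \<eta>)
  case 0
  \<comment> \<open>The zeroth power is the identity of the size of \<open>Q N M\<close>, so even
    this case uses that the size is \<open>N\<close>, which is known for all large
    \<open>M\<close>.\<close>
  have Q: "\<forall>\<^sub>F M in sequentially. Q N M \<in> carrier_mat N N" for N
    using close[of 1 N] by (auto simp: polar_factor_def elim: eventually_mono)
  have "\<forall>\<^sub>F N in sequentially. L2_norm \<omega> (\<lambda>z. g z - dict_comb (\<psi> N) (c N) z) < \<eta>"
    by (rule order_tendstoD(2)[OF conv 0])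
  then show ?case
  proof eventually_elim
    case (elim N)
    show ?case using Q[of N] by eventually_elim (use elim c[of N] in simp)
  qed
next
  case (Suc l)
  \<comment> \<open>The three legs of the path cost \<delta>, \<open>3 * \<delta>\<close> and
    \<open>4 * \<delta>\<close>.\<close>
  define \<delta> where "\<delta> = \<eta> / 8"
  have \<delta>: "0 < \<delta>" using Suc.prems by (simp add: \<delta>_def)
  have Tg: "(T ^^ k) g \<in> L2 \<omega>" for k by (induction k) (auto simp: g T)
  have mem: "dict_comb (\<psi> N) y \<in> L2 \<omega>" if "y \<in> carrier_vec N" for y N
    by (rule L2_dict_comb[OF \<psi> that])
  from Suc.IH[OF \<delta>] eventually_dict_approximation[OF dense[OF Tg[of l]] \<delta>] eventually_dict_approximation[OF dense[OF Tg[of "Suc l"]] \<delta>]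
  show ?case
  proof eventually_elim
    case (elim N)
    obtain u where u: "u \<in> carrier_vec N" and ud: "L2_norm \<omega> (\<lambda>z. (T ^^ l) g z - dict_comb (\<psi> N) u z) < \<delta>"
      using elim(2) by blast
    obtain v where v: "v \<in> carrier_vec N" and vd: "L2_norm \<omega> (\<lambda>z. (T ^^ Suc l) g z - dict_comb (\<psi> N) v z) < \<delta>"
      using elim(3) by blast
    define s where "s = (L2_norm \<omega> (dict_comb (\<psi> N) u))\<^sup>2 + (L2_norm \<omega> (dict_comb (\<psi> N) v))\<^sup>2"
    have s: "0 \<le> s" by (simp add: s_def)
    \<comment> \<open>The vectors \<open>u\<close> and \<open>v\<close> depend on \<open>N\<close>
      but not on \<open>M\<close>, so the tolerance can be fitted to their norms before
      \<open>M\<close> grows.\<close>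
    define \<epsilon> where "\<epsilon> = min (1/2) (\<delta>\<^sup>2 / (10 * s + 1))"
    have \<epsilon>: "0 < \<epsilon>" "\<epsilon> \<le> 1/2" unfolding \<epsilon>_def using \<delta> s by (simp, intro min.cobounded1)
    have \<epsilon>s: "10 * \<epsilon> * s \<le> \<delta>\<^sup>2"
    proof -
      have "\<epsilon> * (10 * s + 1) \<le> \<delta>\<^sup>2 / (10 * s + 1) * (10 * s + 1)"
        using s by (intro mult_right_mono) (auto simp: \<epsilon>_def)
      then have "\<epsilon> * (10 * s + 1) \<le> \<delta>\<^sup>2" using s by simp
      then show ?thesis using \<epsilon> by (simp add: algebra_simps)
    qed
    have Tu: "L2_norm \<omega> (\<lambda>z. (T ^^ Suc l) g z - T (dict_comb (\<psi> N) u) z) < \<delta>"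
      using dist_T[OF Tg[of l] mem[OF u]] ud by simp
    have d: "L2_norm \<omega> (\<lambda>z. T (dict_comb (\<psi> N) u) z - dict_comb (\<psi> N) v z) \<le> 2 * \<delta>"
      using L2_norm_triangle_diff[OF T[OF mem[OF u]] Tg[of "Suc l"] mem[OF v]] Tu vd
        L2_norm_minus_commute[of \<omega> "T (dict_comb (\<psi> N) u)" "(T ^^ Suc l) g"] by linarith
    from close[OF \<epsilon>(1), of N] elim(1)
    show ?case
    proof eventually_elim
      case (elim M)
      let ?q = "Q N M" and ?\<Psi> = "dict_comb (\<psi> N)"
      have P: "polar_factor N (G N M) (B N M) ?q"
        and cG: "form_close \<omega> N (\<psi> N) (\<lambda>f. f) (G N M) \<epsilon>" and cB: "form_close \<omega> N (\<psi> N) T (B N M) \<epsilon>"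
        and IH: "L2_norm \<omega> (\<lambda>z. (T ^^ l) g z - ?\<Psi> ((?q ^\<^sub>m l) *\<^sub>v c N) z) \<le> \<delta>"
        using elim by auto
      have q: "?q \<in> carrier_mat N N" using P by (simp add: polar_factor_def)
      define y where "y = (?q ^\<^sub>m l) *\<^sub>v c N"
      have y: "y \<in> carrier_vec N" unfolding y_def by (rule mult_mat_vec_carrier[OF pow_carrier_mat[OF q] c])
      have qy: "(?q ^\<^sub>m Suc l) *\<^sub>v c N = ?q *\<^sub>v y"
        unfolding pow_mat_Suc_left[OF q] y_def
        by (rule assoc_mult_mat_vec[OF q pow_carrier_mat[OF q] c])
      have qu: "?q *\<^sub>v u \<in> carrier_vec N" and qyc: "?q *\<^sub>v y \<in> carrier_vec N" using q u y by auto
      \<comment> \<open>The distance from \<open>T (\<Psi> u)\<close> to \<open>\<Psi> v\<close> is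
        at most \<open>2 * \<delta>\<close>, and twice its square plus
        \<open>\<delta>\<^sup>2\<close> is \<open>(3 * \<delta>)\<^sup>2\<close>.\<close>
      have 1: "L2_norm \<omega> (\<lambda>z. T (?\<Psi> u) z - ?\<Psi> (?q *\<^sub>v u) z) \<le> 3 * \<delta>"
      proof (rule power2_le_imp_le)
        have "(L2_norm \<omega> (\<lambda>z. T (?\<Psi> u) z - ?\<Psi> (?q *\<^sub>v u) z))\<^sup>2
            \<le> 2 * (L2_norm \<omega> (\<lambda>z. T (?\<Psi> u) z - ?\<Psi> v z))\<^sup>2 + 10 * \<epsilon> * s"
          unfolding s_def
          by (rule polar_factor_step[OF P G B \<psi> T norm_T cG cB _ \<epsilon>(2) u v]) (use \<epsilon> in auto)
        also have "\<dots> \<le> 2 * (2 * \<delta>)\<^sup>2 + \<delta>\<^sup>2"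
          using power_mono[OF d, of 2] \<epsilon>s by simp
        finally show "(L2_norm \<omega> (\<lambda>z. T (?\<Psi> u) z - ?\<Psi> (?q *\<^sub>v u) z))\<^sup>2 \<le> (3 * \<delta>)\<^sup>2"
          by (simp add: power2_eq_square)
      qed (use \<delta> in simp)
      \<comment> \<open>Both \<open>u\<close> and the current iterate \<open>y\<close> lie within
        \<delta> of \<open>T\<^sup>l g\<close>, and \<open>Q\<close> at most doubles their
        distance.\<close>
      have 2: "L2_norm \<omega> (\<lambda>z. ?\<Psi> (?q *\<^sub>v u) z - ?\<Psi> (?q *\<^sub>v y) z) \<le> 4 * \<delta>"
      proof -
        have "L2_norm \<omega> (?\<Psi> (?q *\<^sub>v (u - y))) \<le> 2 * L2_norm \<omega> (?\<Psi> (u - y))"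
          by (rule polar_factor_norm_le[OF P G cG _ \<epsilon>(2)]) (use \<epsilon> u y in auto)
        moreover have "?q *\<^sub>v (u - y) = ?q *\<^sub>v u - ?q *\<^sub>v y"
          by (rule mult_minus_distrib_mat_vec[OF q u y])
        moreover have "L2_norm \<omega> (\<lambda>z. ?\<Psi> u z - ?\<Psi> y z) \<le> 2 * \<delta>"
          using L2_norm_triangle_diff[OF mem[OF u] Tg[of l] mem[OF y]] ud IH
            L2_norm_minus_commute[of \<omega> "?\<Psi> u" "(T ^^ l) g"] by (simp add: y_def)
        ultimately show ?thesis
          by (simp add: dict_comb_minus[OF u y] dict_comb_minus[OF qu qyc])
      qed
      have "L2_norm \<omega> (\<lambda>z. (T ^^ Suc l) g z - ?\<Psi> (?q *\<^sub>v y) z) \<le> \<delta> + 3 * \<delta> + 4 * \<delta>"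
        using L2_norm_triangle_diff[OF Tg[of "Suc l"] T[OF mem[OF u]] mem[OF qyc]]
          L2_norm_triangle_diff[OF T[OF mem[OF u]] mem[OF qu] mem[OF qyc]] Tu 1 2 by linarith
      then show ?case unfolding qy by (simp add: \<delta>_def)
    qed
  qed
qed

lemma limsup_tendsto_0:
  fixes e :: "nat \<Rightarrow> nat \<Rightarrow> real"
  assumes nn: "\<And>N M. 0 \<le> e N M"
    and small: "\<And>\<eta>. 0 < \<eta> \<Longrightarrow> \<forall>\<^sub>F N in sequentially. \<forall>\<^sub>F M in sequentially. e N M \<le> \<eta>"
  shows "(\<lambda>N. limsup (\<lambda>M. ereal (e N M))) \<longlonglongrightarrow> 0"
proof (rule order_tendstoI)
  fix a :: ereal assume a: "a < 0"
  have "0 \<le> limsup (\<lambda>M. ereal (e N M))" for N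
    by (rule le_Limsup) (auto simp: nn)
  then show "\<forall>\<^sub>F N in sequentially. a < limsup (\<lambda>M. ereal (e N M))"
    using a by (intro always_eventually allI) (rule less_le_trans)
next
  fix a :: ereal assume "0 < a"
  then obtain \<eta> where \<eta>: "0 < ereal \<eta>" "ereal \<eta> < a" using ereal_dense2 by blast
  then have "\<forall>\<^sub>F N in sequentially. \<forall>\<^sub>F M in sequentially. e N M \<le> \<eta>" using small by simp
  then show "\<forall>\<^sub>F N in sequentially. limsup (\<lambda>M. ereal (e N M)) < a"
  proof eventually_elim
    case (elim N)
    have "limsup (\<lambda>M. ereal (e N M)) \<le> ereal \<eta>"
      by (rule Limsup_bounded) (use elim in simp)
    then show ?case using \<eta> by simp
  qed
qed

section \<open>The Koopman operator and its adjoint as isometries\<close>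

lemma koopman_L2:
  assumes "measure_preserving \<omega> F" "f \<in> L2 \<omega>"
  shows "koopman F f \<in> L2 \<omega>" "L2_norm \<omega> (koopman F f) = L2_norm \<omega> f"
proof -
  have F: "F \<in> measurable \<omega> \<omega>" and d: "distr \<omega> \<omega> F = \<omega>"
    using assms(1) by (auto simp: measure_preserving_def)
  have f: "f \<in> borel_measurable \<omega>" "integrable \<omega> (\<lambda>x. (cmod (f x))\<^sup>2)"
    using assms(2) by (auto simp: L2_def)
  have m: "(\<lambda>x. (cmod (f x))\<^sup>2) \<in> borel_measurable \<omega>" using f by simp
  have "integrable \<omega> (\<lambda>x. (cmod (f (F x)))\<^sup>2)"
    using f(2) integrable_distr_eq[OF F m] d by simp
  then show "koopman F f \<in> L2 \<omega>"
    using measurable_comp[OF F f(1)] by (simp add: L2_def koopman_def)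
  show "L2_norm \<omega> (koopman F f) = L2_norm \<omega> f"
    using integral_distr[OF F m] d by (simp add: L2_norm_def koopman_def)
qed

text \<open>Testing with \<open>k = f - h\<close> makes the norm of the difference vanish.\<close>

lemma L2_eq_AE_if_inner_eq:
  assumes f: "f \<in> L2 \<omega>" and h: "h \<in> L2 \<omega>"
    and eq: "\<And>k. k \<in> L2 \<omega> \<Longrightarrow> L2_inner \<omega> k f = L2_inner \<omega> k h"
  shows "AE x in \<omega>. f x = h x"
proof -
  have d: "(\<lambda>x. f x - h x) \<in> L2 \<omega>" by (rule L2_diff[OF f h])
  have "L2_inner \<omega> (\<lambda>x. f x - h x) (\<lambda>x. f x - h x)
      = cnj (L2_inner \<omega> (\<lambda>x. f x - h x) f) - cnj (L2_inner \<omega> (\<lambda>x. f x - h x) h)"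
    by (subst L2_inner_diff_left[OF f h d]) (simp add: L2_inner_cnj)
  then have "L2_norm \<omega> (\<lambda>x. f x - h x) = 0"
    using eq[OF d] unfolding L2_inner_self by simp
  from L2_norm_eq_0_AE[OF d this] show ?thesis by simp
qed

text \<open>Unitarity supplies an adjoint \<open>R\<close> that is a right inverse of the Koopman
  operator up to null sets, and \<open>T\<close> agrees with \<open>R\<close> almost everywhere.
  Norms of \<open>R f\<close> and of \<open>R f - R h\<close> are then computed by applying the
  Koopman operator, which preserves norms and is linear pointwise.\<close>

lemma koopman_adjoint_isometry:
  assumes mp: "measure_preserving \<omega> F" and unitary: "L2_unitary \<omega> (koopman F)"
    and adj: "L2_adjoint \<omega> (koopman F) T"
  shows "f \<in> L2 \<omega> \<Longrightarrow> L2_norm \<omega> (T f) = L2_norm \<omega> f"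
    and "f \<in> L2 \<omega> \<Longrightarrow> h \<in> L2 \<omega> \<Longrightarrow> L2_norm \<omega> (\<lambda>z. T f z - T h z) = L2_norm \<omega> (\<lambda>z. f z - h z)"
proof -
  obtain R where R: "L2_adjoint \<omega> (koopman F) R"
    and KR: "\<And>f. f \<in> L2 \<omega> \<Longrightarrow> AE x in \<omega>. koopman F (R f) x = f x"
    using unitary by (auto simp: L2_unitary_def)
  have memR: "f \<in> L2 \<omega> \<Longrightarrow> R f \<in> L2 \<omega>" and memT: "f \<in> L2 \<omega> \<Longrightarrow> T f \<in> L2 \<omega>" for f
    using R adj by (auto simp: L2_adjoint_def)
  have TR: "AE x in \<omega>. T f x = R f x" if f: "f \<in> L2 \<omega>" for f
    using R adj f by (intro L2_eq_AE_if_inner_eq memR memT) (auto simp: L2_adjoint_def)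
  show "L2_norm \<omega> (T f) = L2_norm \<omega> f" if f: "f \<in> L2 \<omega>" for f
  proof -
    have "L2_norm \<omega> (T f) = L2_norm \<omega> (R f)"
      by (rule L2_norm_cong_AE[OF memT[OF f] memR[OF f] TR[OF f]])
    also have "\<dots> = L2_norm \<omega> (koopman F (R f))" by (rule koopman_L2(2)[OF mp memR[OF f], symmetric])
    also have "\<dots> = L2_norm \<omega> f"
      by (rule L2_norm_cong_AE[OF koopman_L2(1)[OF mp memR[OF f]] f KR[OF f]])
    finally show ?thesis .
  qed
  show "L2_norm \<omega> (\<lambda>z. T f z - T h z) = L2_norm \<omega> (\<lambda>z. f z - h z)" if f: "f \<in> L2 \<omega>" and h: "h \<in> L2 \<omega>" for f h
  proof -
    have d: "(\<lambda>z. R f z - R h z) \<in> L2 \<omega>" by (rule L2_diff[OF memR[OF f] memR[OF h]])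
    have "L2_norm \<omega> (\<lambda>z. T f z - T h z) = L2_norm \<omega> (\<lambda>z. R f z - R h z)"
      by (rule L2_norm_cong_AE[OF L2_diff[OF memT[OF f] memT[OF h]] d]) (use TR[OF f] TR[OF h] in eventually_elim, simp)
    also have "\<dots> = L2_norm \<omega> (koopman F (\<lambda>z. R f z - R h z))"
      by (rule koopman_L2(2)[OF mp d, symmetric])
    also have "\<dots> = L2_norm \<omega> (\<lambda>z. f z - h z)"
      by (rule L2_norm_cong_AE[OF koopman_L2(1)[OF mp d] L2_diff[OF f h]])
        (use KR[OF f] KR[OF h] in eventually_elim, simp add: koopman_def)
    finally show ?thesis .
  qed
qed

text \<open>\<open>K N M\<close> is prescribed only where the Gram matrix is invertible; this holds
  for all large \<open>M\<close>, and the other values do not affect the limit superior. The limit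
  superior is taken in the extended reals, where it always exists. Quantifying over
  \<open>Kadj\<close> covers every choice of representatives for the adjoint.\<close>

theorem lemma5p2:
  fixes \<Omega> :: "'a::euclidean_space set"
    and \<omega> :: "'a measure"
    and F :: "'a \<Rightarrow> 'a"
    and \<psi> :: "nat \<Rightarrow> nat \<Rightarrow> 'a \<Rightarrow> complex"
    and x :: "nat \<Rightarrow> nat \<Rightarrow> 'a"
    and w :: "nat \<Rightarrow> nat \<Rightarrow> real"
    and K :: "nat \<Rightarrow> nat \<Rightarrow> complex mat"
    and g :: "'a \<Rightarrow> complex"
    and c :: "nat \<Rightarrow> complex Matrix.vec"
  assumes "space \<omega> = \<Omega>"
    and "measure_preserving \<omega> F"
    and "\<And>N j. j < N \<Longrightarrow> \<psi> N j \<in> L2 \<omega>"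
    and "\<And>N. dict_independent \<omega> N (\<psi> N)"
    and "\<And>M m. m < M \<Longrightarrow> x M m \<in> \<Omega>"
    and "\<And>M m. m < M \<Longrightarrow> 0 \<le> w M m"
    and "\<And>N M. invertible_mat (G_mat M N (\<psi> N) (x M) (w M)) \<Longrightarrow>
           is_mpEDMD N (G_mat M N (\<psi> N) (x M) (w M)) (A_mat M N (\<psi> N) F (x M) (w M)) (K N M)"
    and "\<And>h. h \<in> L2 \<omega> \<Longrightarrow> (\<lambda>N. L2_dist \<omega> h (dict_span N (\<psi> N))) \<longlonglongrightarrow> 0"
    and "\<And>N j k. j < N \<Longrightarrow> k < N \<Longrightarrow>
           (\<lambda>M. G_mat M N (\<psi> N) (x M) (w M) $$ (j, k)) \<longlonglongrightarrow> L2_inner \<omega> (\<psi> N k) (\<psi> N j)"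
    and "\<And>N j k. j < N \<Longrightarrow> k < N \<Longrightarrow>
           (\<lambda>M. A_mat M N (\<psi> N) F (x M) (w M) $$ (j, k))
             \<longlonglongrightarrow> L2_inner \<omega> (koopman F (\<psi> N k)) (\<psi> N j)"
    and "g \<in> L2 \<omega>"
    and "\<And>N. c N \<in> carrier_vec N"
    and "(\<lambda>N. L2_norm \<omega> (\<lambda>z. g z - dict_comb (\<psi> N) (c N) z)) \<longlonglongrightarrow> 0"
  shows "(\<forall>l. (\<lambda>N. limsup (\<lambda>M. ereal (L2_norm \<omega> (\<lambda>z.
              (koopman F ^^ l) g z - dict_comb (\<psi> N) ((K N M ^\<^sub>m l) *\<^sub>v c N) z)))) \<longlonglongrightarrow> 0)
       \<and> (L2_unitary \<omega> (koopman F) \<longrightarrow>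
           (\<forall>Kadj. L2_adjoint \<omega> (koopman F) Kadj \<longrightarrow>
             (\<forall>l. (\<lambda>N. limsup (\<lambda>M. ereal (L2_norm \<omega> (\<lambda>z.
                (Kadj ^^ l) g z - dict_comb (\<psi> N) ((mat_inv (K N M) ^\<^sub>m l) *\<^sub>v c N) z)))) \<longlonglongrightarrow> 0)))"
proof -
  note mp = assms(2) and \<psi> = assms(3) and ind = assms(4) and mpEDMD = assms(7) and dense = assms(8)
    and limG = assms(9) and limA = assms(10) and g = assms(11) and c = assms(12) and conv = assms(13)
  define G where "G N M = G_mat M N (\<psi> N) (x M) (w M)" for N M
  define A where "A N M = A_mat M N (\<psi> N) F (x M) (w M)" for N M
  have Psi: "Psi_mat M N (\<psi> N) z \<in> carrier_mat M N" for M N z by (simp add: Psi_mat_def)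
  have W: "weight_mat M (w M) \<in> carrier_mat M M" for M by (simp add: weight_mat_def mat_diag_def)
  have G: "G N M \<in> carrier_mat N N" and A: "A N M \<in> carrier_mat N N" for N M
    unfolding G_def A_def G_mat_def A_mat_def
    by (rule mult_carrier_mat[OF mult_carrier_mat[OF mat_adjoint_carrier[OF Psi] W] Psi])+
  have closeG: "\<forall>\<^sub>F M in sequentially. form_close \<omega> N (\<psi> N) (\<lambda>f. f) (G N M) \<epsilon>" if "0 < \<epsilon>" for N \<epsilon>
    by (rule eventually_form_close[OF ind]) (use \<psi> G limG that in \<open>auto simp: G_def\<close>)
  have closeA: "\<forall>\<^sub>F M in sequentially. form_close \<omega> N (\<psi> N) (koopman F) (A N M) \<epsilon>" if "0 < \<epsilon>" for N \<epsilon>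
  proof (rule eventually_form_close[OF ind])
    show "koopman F (dict_comb (\<psi> N) u) = dict_comb (\<lambda>j. koopman F (\<psi> N j)) u" for u
      by (auto simp: koopman_def dict_comb_def)
  qed (use \<psi> A limA that koopman_L2(1)[OF mp] in \<open>auto simp: A_def\<close>)
  have polar: "\<forall>\<^sub>F M in sequentially. polar_factor N (G N M) (A N M) (K N M)" for N
    \<comment> \<open>Any tolerance below \<open>1\<close> forces the Gram matrix to be
      invertible.\<close>
    using closeG[of "1/2" N, simplified]
  proof eventually_elim
    case (elim M)
    have "invertible_mat (G N M)"
      by (rule form_close_invertible[OF ind _ G elim]) (use \<psi> in auto)
    then show ?case
      using mpEDMD[of M N] by (intro mpEDMD_polar_factor G A) (auto simp: G_def A_def)
  qed
  have koopman_dist: "L2_norm \<omega> (\<lambda>z. koopman F f z - koopman F h z) = L2_norm \<omega> (\<lambda>z. f z - h z)"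
    if "f \<in> L2 \<omega>" "h \<in> L2 \<omega>" for f h
    using koopman_L2(2)[OF mp L2_diff[OF that]] by (simp add: koopman_def comp_def)
  have fwd: "\<forall>\<^sub>F N in sequentially. \<forall>\<^sub>F M in sequentially.
      L2_norm \<omega> (\<lambda>z. (koopman F ^^ l) g z - dict_comb (\<psi> N) ((K N M ^\<^sub>m l) *\<^sub>v c N) z) \<le> \<eta>"
    if "0 < \<eta>" for l \<eta>
  proof (rule polar_iterates_error[where G=G and B=A])
    show "\<forall>\<^sub>F M in sequentially. polar_factor N (G N M) (A N M) (K N M)
      \<and> form_close \<omega> N (\<psi> N) (\<lambda>f. f) (G N M) \<epsilon> \<and> form_close \<omega> N (\<psi> N) (koopman F) (A N M) \<epsilon>"
      if "0 < \<epsilon>" for N \<epsilon>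
      using polar closeG[OF that] closeA[OF that] by (intro eventually_conj)
  qed (fact \<psi> dense koopman_L2[OF mp] koopman_dist G A g c conv that)+
  have bwd: "\<forall>\<^sub>F N in sequentially. \<forall>\<^sub>F M in sequentially.
      L2_norm \<omega> (\<lambda>z. (T ^^ l) g z - dict_comb (\<psi> N) ((mat_inv (K N M) ^\<^sub>m l) *\<^sub>v c N) z) \<le> \<eta>"
    if un: "L2_unitary \<omega> (koopman F)" and adj: "L2_adjoint \<omega> (koopman F) T" and \<eta>: "0 < \<eta>" for T l \<eta>
  \<comment> \<open>The same iteration is run with the adjoint data: \<open>mat_inv (K N M)\<close>
    is a polar factor for the adjoint of \<open>A N M\<close>, whose form approximates that of
    \<open>T\<close>.\<close>
  proof (rule polar_iterates_error[where G=G and B="\<lambda>N M. mat_adjoint (A N M)"])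
    fix N :: nat and \<epsilon> :: real assume "0 < \<epsilon>"
    with polar[of N] closeG[of \<epsilon> N] closeA[of \<epsilon> N]
    have "\<forall>\<^sub>F M in sequentially. polar_factor N (G N M) (A N M) (K N M)"
      "\<forall>\<^sub>F M in sequentially. form_close \<omega> N (\<psi> N) (\<lambda>f. f) (G N M) \<epsilon>"
      "\<forall>\<^sub>F M in sequentially. form_close \<omega> N (\<psi> N) (koopman F) (A N M) \<epsilon>" by auto
    then show "\<forall>\<^sub>F M in sequentially. polar_factor N (G N M) (mat_adjoint (A N M)) (mat_inv (K N M))
      \<and> form_close \<omega> N (\<psi> N) (\<lambda>f. f) (G N M) \<epsilon> \<and> form_close \<omega> N (\<psi> N) T (mat_adjoint (A N M)) \<epsilon>"
    proof eventually_elim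
      case (elim M)
      then show ?case
        using polar_factor_inverse[OF elim(1) G A] form_close_adjoint[OF A elim(3) \<psi> adj] by simp
    qed
  next
    show "f \<in> L2 \<omega> \<Longrightarrow> T f \<in> L2 \<omega>" for f using adj by (simp add: L2_adjoint_def)
    show "mat_adjoint (A N M) \<in> carrier_mat N N" for N M by (rule mat_adjoint_carrier[OF A])
  qed (fact \<psi> dense koopman_adjoint_isometry[OF mp un adj] G g c conv \<eta>)+
  show ?thesis
    using fwd bwd by (intro conjI allI impI limsup_tendsto_0) auto
qed

end
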